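(* Let $0<\epsilon<\frac12$ and define $\delta=\delta(\epsilon):=\epsilon\,2^{-\frac1\epsilon}$. Then $$Q(x)=\sum_{1\le n<x^{\epsilon}}\frac1n\sin\left(\frac xn\right)+\frac\pi2+O_\epsilon\left(x^{-\delta}\right),$$ that is, there is a constant $C>0$ depending only on $\epsilon$ such that for all real $x\ge1$, $$\left|Q(x)-\sum_{1\le n<x^{\epsilon}}\frac1n\sin\left(\frac xn\right)-\frac\pi2\right|\le C\,x^{-\delta}.$$ Here $n$ ranges over integers.
   Context: The Hardy-Littlewood function is $Q(x):=\sum_{n\ge1}\frac1n\sin\left(\frac xn\right)$. An empty sum equals $0$. *)

theory Defs
  imports "HOL-Analysis.Analysis"
begin

definition hardy_littlewood_Q :: "real \<Rightarrow> real" where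
  "hardy_littlewood_Q x = (\<Sum>n. 1 / real (Suc n) * sin (x / real (Suc n)))"

lemma summable_hardy_littlewood_Q:
  "summable (\<lambda>n. 1 / real (Suc n) * sin (x / real (Suc n)))"
proof (rule summable_comparison_test')
  have "summable (\<lambda>n. inverse (real (Suc n) ^ 2))"
    using inverse_power_summable[of 2, where ?'a = real] by (subst summable_Suc_iff) simp
  then show "summable (\<lambda>n. \<bar>x\<bar> * inverse (real (Suc n) ^ 2))"
    by (rule summable_mult)
next
  fix n :: nat
  have "norm (1 / real (Suc n) * sin (x / real (Suc n)))
      = 1 / real (Suc n) * \<bar>sin (x / real (Suc n))\<bar>"
    by (simp add: abs_mult)
  also have "\<dots> \<le> 1 / real (Suc n) * \<bar>x / real (Suc n)\<bar>"
    by (intro mult_left_mono abs_sin_x_le_abs_x) simp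
  also have "\<dots> = \<bar>x\<bar> * inverse (real (Suc n) ^ 2)"
    by (simp add: field_simps power2_eq_square)
  finally show "norm (1 / real (Suc n) * sin (x / real (Suc n)))
      \<le> \<bar>x\<bar> * inverse (real (Suc n) ^ 2)" .
qed

definition hl_delta :: "real \<Rightarrow> real" where
  "hl_delta \<epsilon> = \<epsilon> * 2 powr (- (1 / \<epsilon>))"

end

theory Submission
  imports Defs "HOL-Probability.Sinc_Integral"
begin

text \<open>
  For \<open>n \<ge> x\<^bsup>2/3\<^esup>\<close> the terms vary slowly, so the sum is close to
  \<open>\<integral> sin (x/t) / t dt = Si (x\<^bsup>1/3\<^esup>)\<close>, which is \<open>\<pi>/2\<close> up to a power of \<open>x\<close>.
  The terms \<open>x\<^bsup>\<epsilon>\<^esup> \<le> n < x\<^bsup>2/3\<^esup>\<close> cancel: on a dyadic block starting at \<open>N = x\<^bsup>\<theta>\<^esup>\<close> van der Corput's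
  estimate of order \<open>k\<close> applies to the phase \<open>x / n\<close>, whose \<open>k\<close>-th difference has size
  \<open>x / N\<^bsup>k+1\<^esup>\<close>. For a suitable \<open>k\<close> near \<open>1/\<theta>\<close> it saves strictly more than
  \<open>x\<^bsup>\<delta>\<^esup>\<close> with \<open>\<delta> = \<theta> 2\<^bsup>-1/\<theta>\<^esup>\<close>, which also absorbs the number of blocks. Finite differences
  take the place of derivatives throughout; this makes van der Corput's induction, which replaces
  \<open>f\<close> by \<open>f (n + t) - f n\<close>, and the phase \<open>x / n\<close> explicit.
\<close>

section \<open>Kusmin--Landau inequality and second difference test\<close>

abbreviation ee :: "real \<Rightarrow> complex" where "ee t \<equiv> cis (2 * pi * t)"

text \<open>Jordan's inequality: on \<open>[0, pi / 2]\<close> the concave sine lies above its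
  chord, and reflection in \<open>t = 1/2\<close> carries this to the other half.\<close>

lemma sin_pi_ge_of_dist_int:
  fixes s t :: real
  assumes "0 < s" "s \<le> t" "t \<le> 1 - s"
  shows "2 * s \<le> sin (pi * t)"
proof -
  have jordan: "2 * u \<le> sin (pi * u)" if "0 \<le> u" "u \<le> 1/2" for u :: real
  proof -
    have "concave_on {0..pi} sin"
    proof (rule f''_le0_imp_concave)
      show "(sin has_real_derivative cos x) (at x)" for x :: real by (rule DERIV_sin)
      show "(cos has_real_derivative - sin x) (at x)" for x :: real by (rule DERIV_cos)
      show "- sin x \<le> 0" if "x \<in> {0..pi}" for x :: real using that by (simp add: sin_ge_zero)
    qed simp
    from concave_onD[OF this, of "2 * u" 0 "pi / 2"] that
    show ?thesis by (simp add: mult.commute)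
  qed
  show ?thesis
  proof (cases "t \<le> 1/2")
    case True
    then show ?thesis using jordan[of t] assms by auto
  next
    case False
    have "sin (pi * t) = sin (pi * (1 - t))"
      by (simp add: algebra_simps sin_diff)
    then show ?thesis using jordan[of "1-t"] False assms by auto
  qed
qed

text \<open>With \<open>w n = 1 / (1 - ee (f (Suc n) - f n))\<close> each term is \<open>w n\<close>
  times a difference of consecutive terms, so partial summation leaves two boundary terms and the
  variation of \<open>w\<close>. The real part of \<open>w\<close> is constant and the imaginary
  part is half a cotangent, monotone because the differences of \<open>f\<close> increase; hence the
  variation telescopes.\<close>

lemma kusmin_landau:
  fixes f :: "nat \<Rightarrow> real" and m :: int
  assumes s: "0 < s"
    and lo: "\<And>n. n < L \<Longrightarrow> of_int m + s \<le> f (Suc n) - f n"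
    and hi: "\<And>n. n < L \<Longrightarrow> f (Suc n) - f n \<le> of_int m + 1 - s"
    and mono: "\<And>n. Suc n < L \<Longrightarrow> f (Suc n) - f n \<le> f (Suc (Suc n)) - f (Suc n)"
  shows "norm (\<Sum>n<L. ee (f n)) \<le> 1 / s"
proof (cases L)
  case 0
  then show ?thesis using s by simp
next
  case (Suc M)
  define D where "D n = f (Suc n) - f n - of_int m" for n
  define c where "c n = cos (pi * D n) / sin (pi * D n)" for n
  \<comment> \<open>This is \<open>(1 + i cot a) / 2\<close> for \<open>a = pi * D n\<close>, the
    explicit reciprocal of \<open>1 - cis (2 * a)\<close>.\<close>
  define w where "w n = Complex (1/2) (c n / 2)" for n
  have D: "s \<le> D n" "D n \<le> 1 - s" if "n \<le> M" for n
    using lo[of n] hi[of n] that Suc by (auto simp: D_def)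
  have sinD: "2 * s \<le> sin (pi * D n)" if "n \<le> M" for n
    using sin_pi_ge_of_dist_int[OF s D[OF that]] .
  have sin0: "0 < sin (pi * D n)" if "n \<le> M" for n
    using sinD[OF that] s by linarith
  have step: "ee (f (Suc n)) = ee (f n) * cis (2 * (pi * D n))" for n
  proof -
    have "ee (f n) * cis (2 * (pi * D n)) = cis (2 * pi * f (Suc n) - 2 * pi * of_int m)"
      by (simp add: cis_mult D_def algebra_simps)
    also have "\<dots> = ee (f (Suc n))"
      by (metis cis_divide cis_multiple_2pi Ints_of_int div_by_1)
    finally show ?thesis by simp
  qed
  have w1: "w n * (1 - cis (2 * (pi * D n))) = 1" if "n \<le> M" for n
  proof -
    let ?a = "pi * D n"
    have nz: "sin ?a \<noteq> 0" using sin0[OF that] by simp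
    have c2: "cos (2 * ?a) = 1 - 2 * (sin ?a * sin ?a)"
      by (simp add: cos_double_sin power2_eq_square)
    have s2: "sin (2 * ?a) = 2 * sin ?a * cos ?a" by (rule sin_double)
    have sc: "cos ?a * cos ?a = 1 - sin ?a * sin ?a"
      using sin_cos_squared_add[of ?a] by (simp add: power2_eq_square)
    show ?thesis
      unfolding w_def c_def complex_eq_iff
      using nz sc by (simp add: c2 s2)
  qed
  define G where "G n = ee (f n)" for n
  have g: "G n = w n * G n - w n * G (Suc n)" if "n \<le> M" for n
  proof -
    have "w n * G n - w n * G (Suc n) = (w n * (1 - cis (2 * (pi * D n)))) * G n"
      unfolding G_def step by (simp add: algebra_simps)
    then show ?thesis using w1[OF that] by simp
  qed
  have abel: "(\<Sum>n<Suc k. G n) = w 0 * G 0 - w k * G (Suc k)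
      + (\<Sum>n<k. (w (Suc n) - w n) * G (Suc n))" if "k \<le> M" for k
    using that
  proof (induction k)
    case 0
    then show ?case using g[of 0] by simp
  next
    case (Suc k)
    have "(\<Sum>n<Suc (Suc k). G n) = (\<Sum>n<Suc k. G n) + (w (Suc k) * G (Suc k) - w (Suc k) * G (Suc (Suc k)))"
      using g[of "Suc k"] Suc.prems by simp
    also have "(\<Sum>n<Suc k. G n) = w 0 * G 0 - w k * G (Suc k)
        + (\<Sum>n<k. (w (Suc n) - w n) * G (Suc n))"
      using Suc by simp
    finally show ?case by (simp add: left_diff_distrib)
  qed
  \<comment> \<open>The modulus is exactly \<open>1 / (2 * sin (pi * D n))\<close>; the distance
    \<open>s\<close> from the integers enters through Jordan's inequality.\<close>
  have wn: "norm (w n) \<le> 1 / (4 * s)" if "n \<le> M" for n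
  proof -
    have "(norm (w n))\<^sup>2 = (1 / (2 * sin (pi * D n)))\<^sup>2"
      using sin0[OF that] sin_cos_squared_add[of "pi * D n"]
      by (simp add: w_def c_def cmod_power2 power_divide field_simps)
    then have "norm (w n) = 1 / (2 * sin (pi * D n))"
      using sin0[OF that] by (simp add: power2_eq_iff_nonneg)
    also have "\<dots> \<le> 1 / (4 * s)"
      using sinD[OF that] s by (intro divide_left_mono) auto
    finally show ?thesis .
  qed
  have cn: "\<bar>c n\<bar> \<le> 1 / (2 * s)" if "n \<le> M" for n
  proof -
    have "\<bar>c n / 2\<bar> \<le> norm (w n)"
      using abs_Im_le_cmod[of "w n"] by (simp add: w_def)
    with wn[OF that] show ?thesis by (simp add: field_simps)
  qed
  have cmono: "c (Suc n) \<le> c n" if "n < M" for n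
  proof -
    have le: "D n \<le> D (Suc n)" using mono[of n] that Suc by (simp add: D_def)
    have "0 \<le> sin (pi * D (Suc n) - pi * D n)"
    proof (rule sin_ge_zero)
      show "0 \<le> pi * D (Suc n) - pi * D n" using le by simp
      have "D (Suc n) - D n \<le> 1" using D[of n] D[of "Suc n"] that s by auto
      then have "pi * (D (Suc n) - D n) \<le> pi * 1" by (intro mult_left_mono) auto
      then show "pi * D (Suc n) - pi * D n \<le> pi" by (simp add: algebra_simps)
    qed
    moreover have "c n - c (Suc n) = sin (pi * D (Suc n) - pi * D n) / (sin (pi * D n) * sin (pi * D (Suc n)))"
      using sin0[of n] sin0[of "Suc n"] that by (simp add: c_def sin_diff field_simps)
    ultimately show ?thesis using sin0[of n] sin0[of "Suc n"] that
      by (metis diff_ge_0_iff_ge divide_nonneg_nonneg less_imp_le mult_nonneg_nonneg Suc_leI)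
  qed
  have "norm (\<Sum>n<M. (w (Suc n) - w n) * ee (f (Suc n))) \<le> (\<Sum>n<M. (c n - c (Suc n)) / 2)"
  proof (intro sum_norm_le)
    fix n assume "n \<in> {..<M}"
    then have "c (Suc n) \<le> c n" using cmono by simp
    moreover have "w (Suc n) - w n = Complex 0 ((c (Suc n) - c n) / 2)"
      by (simp add: w_def complex_eq_iff diff_divide_distrib)
    ultimately have "norm (w (Suc n) - w n) = (c n - c (Suc n)) / 2"
      by (simp add: cmod_def)
    then show "norm ((w (Suc n) - w n) * ee (f (Suc n))) \<le> (c n - c (Suc n)) / 2"
      by (simp add: norm_mult)
  qed
  also have "\<dots> = (c 0 - c M) / 2"
    by (simp add: sum_divide_distrib[symmetric] sum_lessThan_telescope')
  also have "\<dots> \<le> 1 / (2 * s)"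
    using cn[of 0] cn[of M] by (simp add: abs_le_iff)
  finally have 1: "norm (\<Sum>n<M. (w (Suc n) - w n) * ee (f (Suc n))) \<le> 1 / (2 * s)" .
  have 2: "norm (w 0 * ee (f 0)) \<le> 1 / (4 * s)" "norm (w M * ee (f (Suc M))) \<le> 1 / (4 * s)"
    using wn[of 0] wn[of M] by (auto simp: norm_mult)
  have "norm (\<Sum>n<L. ee (f n)) \<le> norm (w 0 * ee (f 0)) + norm (w M * ee (f (Suc M)))
      + norm (\<Sum>n<M. (w (Suc n) - w n) * ee (f (Suc n)))"
    unfolding Suc abel[OF order_refl, unfolded G_def]
    by (intro order_trans[OF norm_triangle_ineq] add_right_mono norm_triangle_ineq4)
  also have "\<dots> \<le> 1 / (4 * s) + 1 / (4 * s) + 1 / (2 * s)"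
    using 1 2 by (intro add_mono)
  also have "\<dots> = 1 / s" by (simp add: field_simps)
  finally show ?thesis .
qed

text \<open>The extreme indices of \<open>X\<close> are at most \<open>w / \<mu>\<close> apart. This
  counts the terms whose first difference is too close to an integer for
  \<open>kusmin_landau\<close>.\<close>

lemma card_le_of_spaced:
  fixes d :: "nat \<Rightarrow> real"
  assumes "finite X" and lam: "0 < \<mu>" and w: "0 \<le> w"
    and sp: "\<And>i j. i \<in> X \<Longrightarrow> j \<in> X \<Longrightarrow> i \<le> j \<Longrightarrow> real (j - i) * \<mu> \<le> d j - d i"
    and rg: "\<And>i. i \<in> X \<Longrightarrow> u \<le> d i \<and> d i \<le> u + w"
  shows "real (card X) \<le> w / \<mu> + 1"
proof (cases "X = {}")
  case True
  then show ?thesis using lam w by simp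
next
  case False
  let ?a = "Min X" and ?b = "Max X"
  have ab: "?a \<in> X" "?b \<in> X" "?a \<le> ?b" using False assms(1) by auto
  have "X \<subseteq> {?a..?b}" using assms(1) by auto
  then have "card X \<le> card {?a..?b}" by (intro card_mono) auto
  then have "real (card X) \<le> real (?b - ?a) + 1" using ab by simp
  moreover have "real (?b - ?a) * \<mu> \<le> w"
    using sp[OF ab] rg[OF ab(1)] rg[OF ab(2)] by linarith
  then have "real (?b - ?a) \<le> w / \<mu>" using lam by (simp add: field_simps)
  ultimately show ?thesis by linarith
qed

text \<open>The first difference \<open>d\<close> increases by steps between \<open>\<mu>\<close>
  and \<open>h * \<mu>\<close>, so its floor takes at most \<open>L * h * \<mu> + 2\<close> values.
  On each piece the terms with \<open>d n\<close> within \<open>s\<close> of an integer are counted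
  trivially, about \<open>s / \<mu>\<close> of them at each end, and the rest costs
  \<open>1 / s\<close>; the choice \<open>s = sqrt \<mu>\<close> balances the two.\<close>

lemma second_difference_test:
  fixes f :: "nat \<Rightarrow> real"
  assumes lam: "0 < \<mu>" and h: "1 \<le> h"
    and f2: "\<And>n. n < L \<Longrightarrow> \<mu> \<le> f (Suc (Suc n)) - f (Suc n) - (f (Suc n) - f n)"
    and f2': "\<And>n. n < L \<Longrightarrow> f (Suc (Suc n)) - f (Suc n) - (f (Suc n) - f n) \<le> h * \<mu>"
  shows "norm (\<Sum>n<L. ee (f n)) \<le> 10 * h * (real L * sqrt \<mu> + 1 / sqrt \<mu>)"
proof (cases "\<mu> \<ge> 1/4")
  \<comment> \<open>Here \<open>sqrt \<mu>\<close> is at least 1/2, so the trivial bound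
    \<open>L\<close> suffices. In the other case \<open>s < 1/2\<close>, which keeps the zones
    \<open>X1\<close>, \<open>X2\<close>, \<open>X3\<close> disjoint.\<close>
  case True
  then have "sqrt (1/4) \<le> sqrt \<mu>" by (intro real_sqrt_le_mono)
  then have r: "1/2 \<le> sqrt \<mu>" by (simp add: real_sqrt_divide)
  have "norm (\<Sum>n<L. ee (f n)) \<le> real L"
    using sum_norm_le[of "{..<L}" "\<lambda>n. ee (f n)" "\<lambda>_. 1"] by simp
  also have "\<dots> \<le> 10 * h * (real L * sqrt \<mu>)"
  proof -
    have "1 * 1 \<le> (2 * h) * (2 * sqrt \<mu>)" using h r by (intro mult_mono) auto
    then have "real L * 1 \<le> real L * (10 * h * sqrt \<mu>)" using h r
      by (intro mult_left_mono) auto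
    then show ?thesis by (simp add: mult_ac)
  qed
  also have "\<dots> \<le> 10 * h * (real L * sqrt \<mu> + 1 / sqrt \<mu>)"
    using h lam by (intro mult_left_mono) auto
  finally show ?thesis .
next
  case False
  define s where "s = sqrt \<mu>"
  have s: "0 < s" "s * s = \<mu>" using lam by (auto simp: s_def)
  have s1: "s < 1/2"
    using False lam real_sqrt_less_mono[of \<mu> "1/4"] by (simp add: s_def real_sqrt_divide)
  define d where "d n = f (Suc n) - f n" for n
  have dlo: "d i + real k * \<mu> \<le> d (i + k)" if "i + k \<le> L" for i k
    using that
  proof (induction k)
    case (Suc k)
    then show ?case using f2[of "i+k"] by (auto simp: d_def algebra_simps)
  qed simp
  have dhi: "d (i + k) \<le> d i + real k * (h * \<mu>)" if "i + k \<le> L" for i k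
    using that
  proof (induction k)
    case (Suc k)
    then show ?case using f2'[of "i+k"] by (auto simp: d_def algebra_simps)
  qed simp
  have spaced: "real (j - i) * \<mu> \<le> d j - d i" if "i \<le> j" "j \<le> L" for i j
    using dlo[of i "j-i"] that by simp
  have dmono: "d i \<le> d j" if "i \<le> j" "j \<le> L" for i j
    using spaced[OF that] lam by (smt (verit) of_nat_0_le_iff zero_le_mult_iff)
  define A where "A m = {n \<in> {..<L}. \<lfloor>d n\<rfloor> = m}" for m
  define I where "I = (\<lambda>n. \<lfloor>d n\<rfloor>) ` {..<L}"
  have piece: "norm (\<Sum>n\<in>A m. ee (f n)) \<le> 5 / s" for m
  proof -
    define X1 where "X1 = {n \<in> {..<L}. of_int m \<le> d n \<and> d n < of_int m + s}"
    define X2 where "X2 = {n \<in> {..<L}. of_int m + s \<le> d n \<and> d n \<le> of_int m + 1 - s}"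
    define X3 where "X3 = {n \<in> {..<L}. of_int m + 1 - s < d n \<and> d n < of_int m + 1}"
    have fin: "finite X1" "finite X2" "finite X3" by (auto simp: X1_def X2_def X3_def)
    have A: "A m = X1 \<union> X2 \<union> X3" 
      using s s1 by (auto simp: A_def X1_def X2_def X3_def floor_eq_iff)
    have dis: "X1 \<inter> X2 = {}" "(X1 \<union> X2) \<inter> X3 = {}"
      using s s1 by (auto simp: X1_def X2_def X3_def)
    have triv: "norm (\<Sum>n\<in>X. ee (f n)) \<le> real (card X)" for X
      using sum_norm_le[of X "\<lambda>n. ee (f n)" "\<lambda>_. 1"] by simp
    have "real (card X1) \<le> s / \<mu> + 1"
      using fin lam s spaced
      by (intro card_le_of_spaced[where d = d and u = "of_int m"]) (auto simp: X1_def)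
    moreover have "real (card X3) \<le> s / \<mu> + 1"
      using fin lam s spaced
      by (intro card_le_of_spaced[where d = d and u = "of_int m + 1 - s"]) (auto simp: X3_def)
    moreover have "s / \<mu> = 1 / s" using s by (simp add: s(2)[symmetric])
    ultimately have 13: "norm (\<Sum>n\<in>X1. ee (f n)) \<le> 1 / s + 1" "norm (\<Sum>n\<in>X3. ee (f n)) \<le> 1 / s + 1"
      using triv[of X1] triv[of X3] by auto
    have 2: "norm (\<Sum>n\<in>X2. ee (f n)) \<le> 1 / s"
    proof (cases "X2 = {}")
      case True
      then show ?thesis using s by simp
    next
      case False
      \<comment> \<open>Monotonicity of \<open>d\<close> makes the middle zone \<open>X2\<close> an
        interval of indices, as \<open>kusmin_landau\<close> requires.\<close>
      define p q where "p = Min X2" and "q = Max X2"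
      have ab: "p \<in> X2" "q \<in> X2" "p \<le> q" using False fin by (auto simp: p_def q_def)
      have bL: "q < L" using ab by (auto simp: X2_def)
      have in2: "n \<in> X2" if "p \<le> n" "n \<le> q" for n
        using dmono[of p n] dmono[of n q] ab that bL by (auto simp: X2_def)
      have "n \<in> {p..q}" if "n \<in> X2" for n
        using Min_le[OF fin(2) that] Max_ge[OF fin(2) that] by (simp add: p_def q_def)
      with in2 have X2: "X2 = {p..q}" by (metis atLeastAtMost_iff subsetI subset_antisym)
      have "(\<Sum>n\<in>X2. ee (f n)) = (\<Sum>n\<in>{0 + p..<(Suc q - p) + p}. ee (f n))"
        using X2 ab by (simp add: atLeastLessThanSuc_atLeastAtMost)
      also have "\<dots> = (\<Sum>n<Suc q - p. ee (f (n + p)))"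
        by (subst sum.shift_bounds_nat_ivl) (simp add: lessThan_atLeast0)
      also have "norm \<dots> \<le> 1 / s"
      proof (rule kusmin_landau[OF s(1), where m = m])
        fix n assume n: "n < Suc q - p"
        then have "n + p \<in> X2" using ab by (intro in2) auto
        then show "of_int m + s \<le> f (Suc n + p) - f (n + p)"
          and "f (Suc n + p) - f (n + p) \<le> of_int m + 1 - s"
          by (auto simp: X2_def d_def)
      next
        fix n assume n: "Suc n < Suc q - p"
        then show "f (Suc n + p) - f (n + p) \<le> f (Suc (Suc n) + p) - f (Suc n + p)"
          using dmono[of "n + p" "Suc (n + p)"] bL by (auto simp: d_def)
      qed
      finally show ?thesis .
    qed
    have "(\<Sum>n\<in>A m. ee (f n)) = (\<Sum>n\<in>X1. ee (f n)) + (\<Sum>n\<in>X2. ee (f n)) + (\<Sum>n\<in>X3. ee (f n))"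
      using fin dis by (simp add: A sum.union_disjoint)
    also have "norm \<dots> \<le> (1 / s + 1) + 1 / s + (1 / s + 1)"
      using 13 2 by (intro norm_triangle_mono)
    also have "\<dots> \<le> 5 / s"
    proof -
      have "1 \<le> 1 / s" using s s1 by simp
      then show ?thesis by (simp add: divide_inverse)
    qed
    finally show ?thesis .
  qed
  have split: "(\<Sum>n<L. ee (f n)) = (\<Sum>m\<in>I. \<Sum>n\<in>A m. ee (f n))"
    unfolding I_def A_def by (rule sum.image_gen) simp
  have cardI: "real (card I) \<le> real L * (h * \<mu>) + 2"
  proof (cases "L = 0")
    case True
    then show ?thesis by (simp add: I_def)
  next
    case False
    have "I \<subseteq> {\<lfloor>d 0\<rfloor>..\<lfloor>d L\<rfloor>}"
      using dmono by (auto simp: I_def intro!: floor_mono)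
    then have "card I \<le> card {\<lfloor>d 0\<rfloor>..\<lfloor>d L\<rfloor>}" by (intro card_mono) auto
    moreover have "\<lfloor>d 0\<rfloor> \<le> \<lfloor>d L\<rfloor>" using dmono by (auto intro!: floor_mono)
    ultimately have "real (card I) \<le> of_int \<lfloor>d L\<rfloor> - of_int \<lfloor>d 0\<rfloor> + 1" by simp
    also have "\<dots> \<le> d L - d 0 + 2" by linarith
    also have "\<dots> \<le> real L * (h * \<mu>) + 2" using dhi[of 0 L] by simp
    finally show ?thesis .
  qed
  have "norm (\<Sum>n<L. ee (f n)) \<le> (\<Sum>m\<in>I. 5 / s)"
    unfolding split using piece by (intro sum_norm_le)
  also have "\<dots> = real (card I) * (5 / s)" by simp
  also have "\<dots> \<le> (real L * (h * \<mu>) + 2) * (5 / s)"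
    using cardI s by (intro mult_right_mono) auto
  also have "\<dots> = 5 * h * (real L * s) + 10 * 1 * (1 / s)"
    using s by (simp add: s(2)[symmetric] field_simps)
  also have "\<dots> \<le> 10 * h * (real L * s) + 10 * h * (1 / s)"
    using s h by (intro add_mono mult_right_mono) auto
  finally show ?thesis by (simp add: s_def algebra_simps)
qed

section \<open>Van der Corput estimates by iterated differencing\<close>

text \<open>Summing \<open>q\<close> shifted copies of \<open>z\<close> multiplies the sum by
  \<open>q\<close>. Cauchy-Schwarz over the at most \<open>2 * L\<close> positions and expansion of
  the square leave correlations of \<open>z\<close> with its own shifts.\<close>

lemma weyl_van_der_corput:
  fixes z :: "nat \<Rightarrow> complex"
  assumes q: "1 \<le> q" "q \<le> L" and z: "\<And>n. n < L \<Longrightarrow> norm (z n) \<le> 1"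
  shows "real q * (norm (\<Sum>n<L. z n))\<^sup>2
    \<le> 2 * real L * (real L + 2 * (\<Sum>t=1..<q. norm (\<Sum>n<L-t. z (n + t) * cnj (z n))))"
proof -
  define y where "y n = (if n < L then z n else 0)" for n
  \<comment> \<open>The copy of \<open>z\<close> shifted by \<open>r\<close> and extended by zero;
    the guard \<open>r \<le> m\<close> is needed because subtraction on naturals truncates.\<close>
  define a where "a m r = (if r \<le> m then y (m - r) else 0)" for m r :: nat
  define W where "W m = (\<Sum>r<q. a m r)" for m
  define R where "R t = norm (\<Sum>n<L-t. z (n + t) * cnj (z n))" for t
  define P where "P = (\<Sum>t=1..<q. R t)"
  have shift: "(\<Sum>m<L+q. if r \<le> m then F (m - r) else 0) = (\<Sum>n<L+q-r. F n)" if "r < q" 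
    for r and F :: "nat \<Rightarrow> complex"
  proof -
    have "(\<Sum>m<L+q. if r \<le> m then F (m - r) else 0) = (\<Sum>m=r..<L+q. F (m - r))"
      by (intro sum.mono_neutral_cong_right) auto
    also have "\<dots> = (\<Sum>m=0+r..<(L+q-r)+r. F (m - r))" using that by simp
    also have "\<dots> = (\<Sum>n<L+q-r. F n)"
      by (subst sum.shift_bounds_nat_ivl) (simp add: lessThan_atLeast0)
    finally show ?thesis .
  qed
  have col: "(\<Sum>m<L+q. a m r) = (\<Sum>n<L. z n)" if "r < q" for r
  proof -
    have "(\<Sum>m<L+q. a m r) = (\<Sum>n<L+q-r. y n)"
      unfolding a_def using shift[OF that, of y] .
    also have "\<dots> = (\<Sum>n<L. z n)"
      using that by (intro sum.mono_neutral_cong_right) (auto simp: y_def)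
    finally show ?thesis .
  qed
  have sumW: "(\<Sum>m<L+q. W m) = of_nat q * (\<Sum>n<L. z n)"
    unfolding W_def by (subst sum.swap) (simp add: col)
  have corr: "(\<Sum>m<L+q. a m r * cnj (a m s)) = (\<Sum>n<L-(s-r). z (n + (s-r)) * cnj (z n))"
    if "r \<le> s" "s < q" for r s
  proof -
    have "(\<Sum>m<L+q. a m r * cnj (a m s))
        = (\<Sum>m<L+q. if s \<le> m then y (m - s + (s - r)) * cnj (y (m - s)) else 0)"
      using that by (intro sum.cong) (auto simp: a_def)
    also have "\<dots> = (\<Sum>n<L+q-s. y (n + (s - r)) * cnj (y n))"
      using shift[OF that(2), of "\<lambda>n. y (n + (s - r)) * cnj (y n)"] .
    also have "\<dots> = (\<Sum>n<L-(s-r). z (n + (s-r)) * cnj (z n))"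
      using that by (intro sum.mono_neutral_cong_right) (auto simp: y_def)
    finally show ?thesis .
  qed
  \<comment> \<open>With truncated subtraction \<open>(s - r) + (r - s)\<close> is the distance of
    \<open>r\<close> and \<open>s\<close>; conjugation makes the correlation symmetric in
    norm.\<close>
  have corrR: "norm (\<Sum>m<L+q. a m r * cnj (a m s)) = R ((s - r) + (r - s))" if "r < q" "s < q" for r s
  proof (cases "r \<le> s")
    case True
    then show ?thesis using corr[OF True that(2)] by (simp add: R_def)
  next
    case False
    have "norm (\<Sum>m<L+q. a m r * cnj (a m s)) = norm (cnj (\<Sum>m<L+q. a m s * cnj (a m r)))"
      by (simp add: cnj_sum mult.commute)
    also have "\<dots> = norm (\<Sum>m<L+q. a m s * cnj (a m r))"
      by (rule complex_mod_cnj)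
    finally show ?thesis using corr[of s r] that False by (simp add: R_def)
  qed
  have R0: "R 0 \<le> real L"
  proof -
    have "norm (\<Sum>n<L. z n * cnj (z n)) \<le> real (card {..<L}) * 1"
      using z by (intro sum_norm_bound) (auto simp: norm_mult mult_le_one)
    then show ?thesis by (simp add: R_def)
  qed
  have Rnn: "0 \<le> R t" for t by (simp add: R_def)
  \<comment> \<open>For fixed \<open>r\<close> each positive distance occurs at most twice, once on
    either side of \<open>r\<close>.\<close>
  have row: "(\<Sum>s<q. R ((s - r) + (r - s))) \<le> real L + 2 * P" if "r < q" for r
  proof -
    have "{..<q} = {..<r} \<union> {r} \<union> {r<..<q}" using that by auto
    then have "(\<Sum>s<q. R ((s - r) + (r - s)))
        = (\<Sum>s\<in>{..<r} \<union> {r} \<union> {r<..<q}. R ((s - r) + (r - s)))" by simp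
    also have "\<dots> = (\<Sum>s<r. R ((s - r) + (r - s))) + R 0 + (\<Sum>s\<in>{r<..<q}. R ((s - r) + (r - s)))"
      by (subst sum.union_disjoint, auto)+
    also have "(\<Sum>s<r. R ((s - r) + (r - s))) = (\<Sum>t=1..r. R t)"
      by (rule sum.reindex_bij_witness[where i = "\<lambda>t. r - t" and j = "\<lambda>s. r - s"]) auto
    also have "(\<Sum>s\<in>{r<..<q}. R ((s - r) + (r - s))) = (\<Sum>t=1..<q-r. R t)"
      by (rule sum.reindex_bij_witness[where i = "\<lambda>t. r + t" and j = "\<lambda>s. s - r"]) auto
    also have "(\<Sum>t=1..r. R t) + R 0 + (\<Sum>t=1..<q-r. R t) \<le> P + real L + P"
      unfolding P_def using R0 Rnn that by (intro add_mono sum_mono2) auto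
    finally show ?thesis by simp
  qed
  have W2: "(\<Sum>m<L+q. (norm (W m))\<^sup>2) \<le> real q * (real L + 2 * P)"
  proof -
    have "complex_of_real (\<Sum>m<L+q. (norm (W m))\<^sup>2) = (\<Sum>m<L+q. W m * cnj (W m))"
      by (simp add: complex_norm_square del: of_real_power)
    also have "\<dots> = (\<Sum>m<L+q. \<Sum>r<q. \<Sum>s<q. a m r * cnj (a m s))"
      unfolding W_def by (simp add: cnj_sum sum_product)
    also have "\<dots> = (\<Sum>r<q. \<Sum>m<L+q. \<Sum>s<q. a m r * cnj (a m s))"
      by (rule sum.swap)
    also have "\<dots> = (\<Sum>r<q. \<Sum>s<q. \<Sum>m<L+q. a m r * cnj (a m s))"
      by (intro sum.cong refl sum.swap)
    finally have eq: "complex_of_real (\<Sum>m<L+q. (norm (W m))\<^sup>2)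
      = (\<Sum>r<q. \<Sum>s<q. \<Sum>m<L+q. a m r * cnj (a m s))" .
    have "(\<Sum>m<L+q. (norm (W m))\<^sup>2) = norm (complex_of_real (\<Sum>m<L+q. (norm (W m))\<^sup>2))"
      unfolding norm_of_real by (intro abs_of_nonneg[symmetric] sum_nonneg) simp
    also have "\<dots> \<le> (\<Sum>r<q. \<Sum>s<q. norm (\<Sum>m<L+q. a m r * cnj (a m s)))"
      unfolding eq by (intro sum_norm_le order_refl)
    also have "\<dots> = (\<Sum>r<q. \<Sum>s<q. R ((s - r) + (r - s)))"
      by (intro sum.cong refl corrR) auto
    also have "\<dots> \<le> (\<Sum>r<q. real L + 2 * P)"
      by (intro sum_mono row) auto
    finally show ?thesis by simp
  qed
  have "(norm (of_nat q * (\<Sum>n<L. z n)))\<^sup>2 \<le> (\<Sum>m<L+q. norm (W m))\<^sup>2"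
    unfolding sumW[symmetric] by (intro power_mono norm_sum) auto
  also have "\<dots> \<le> (\<Sum>m<L+q. (norm (W m))\<^sup>2) * real (card {..<L+q})"
    using sum_squared_le_sum_of_squares[of "\<lambda>m. norm (W m)" "{..<L+q}"] by (simp add: mult.commute)
  also have "\<dots> \<le> (real q * (real L + 2 * P)) * real (L + q)"
    using W2 by (simp add: mult_right_mono)
  also have "\<dots> \<le> (real q * (real L + 2 * P)) * (2 * real L)"
    using q Rnn by (intro mult_left_mono mult_nonneg_nonneg) (auto simp: P_def intro!: add_nonneg_nonneg sum_nonneg)
  finally have "real q * (real q * (norm (\<Sum>n<L. z n))\<^sup>2) \<le> real q * (2 * real L * (real L + 2 * P))"
    by (simp add: norm_mult power_mult_distrib power2_eq_square mult_ac)
  then show ?thesis using q by (simp add: P_def R_def)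
qed

definition fdiff :: "(nat \<Rightarrow> real) \<Rightarrow> nat \<Rightarrow> real" where
  "fdiff f n = f (Suc n) - f n"

lemma fdiff_funpow_shift_diff:
  "(fdiff ^^ k) (\<lambda>n. f (n + t) - f n) n = (fdiff ^^ k) f (n + t) - (fdiff ^^ k) f n"
  by (induction k arbitrary: n) (simp_all add: fdiff_def)

text \<open>This drives the induction on the order: if the differences of order \<open>k + 1\<close>
  lie between \<open>\<mu>\<close> and \<open>h * \<mu>\<close>, those of order \<open>k\<close> of
  the shifted difference lie between \<open>t * \<mu>\<close> and \<open>h * (t * \<mu>)\<close>,
  with the same ratio \<open>h\<close>.\<close>

lemma fdiff_funpow_shift_diff_sum:
  "(fdiff ^^ k) (\<lambda>n. f (n + t) - f n) n = (\<Sum>j<t. (fdiff ^^ Suc k) f (n + j))"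
proof -
  have "(\<Sum>j<t. (fdiff ^^ Suc k) f (n + j)) = (fdiff ^^ k) f (n + t) - (fdiff ^^ k) f n"
    by (induction t) (simp_all add: fdiff_def)
  then show ?thesis by (simp add: fdiff_funpow_shift_diff)
qed

lemma sum_inverse_sqrt_le: "(\<Sum>t=1..q. real t powr (-1/2)) \<le> 2 * real q powr (1/2)"
proof (induction q)
  case (Suc q)
  define a b where "a = sqrt (real q)" and "b = sqrt (real (Suc q))"
  have a: "0 \<le> a" "a * a = real q" and b: "0 < b" "b * b = real q + 1"
    by (auto simp: a_def b_def)
  have pa: "real q powr (1/2) = a" "real (Suc q) powr (1/2) = b"
    by (auto simp: a_def b_def powr_half_sqrt)
  have pm: "real (Suc q) powr (-1/2) = 1 / b"
    using pa(2) powr_minus_divide[of "real (Suc q)" "1/2"] by simp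
  \<comment> \<open>\<open>2 * (b - a) * b\<close> equals \<open>(b - a)^2 + (b^2 - a^2)\<close>,
    where the second summand is 1.\<close>
  have "0 \<le> (b - a) * (b - a)" by simp
  then have "1 \<le> 2 * (b - a) * b" using a b by (simp add: algebra_simps)
  then have "1 / b \<le> 2 * (b - a)" using b by (simp add: divide_le_eq)
  then show ?case using Suc pa pm by simp
qed simp

text \<open>Splitting off \<open>t powr (1/2 - E)\<close>, which is largest at \<open>q\<close>,
  reduces to exponent -1/2 and keeps the constant independent of \<open>E\<close>.\<close>

lemma sum_powr_neg_le:
  assumes "0 \<le> E" "E \<le> 1/2"
  shows "(\<Sum>t=1..<q. real t powr (-E)) \<le> 2 * real q powr (1 - E)"
proof -
  have "(\<Sum>t=1..<q. real t powr (-E)) \<le> (\<Sum>t=1..<q. real q powr (1/2 - E) * real t powr (-1/2))"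
  proof (intro sum_mono)
    fix t assume t: "t \<in> {1..<q}"
    have "real t powr (-E) = real t powr (1/2 - E) * real t powr (-1/2)"
      by (simp add: powr_add[symmetric])
    also have "\<dots> \<le> real q powr (1/2 - E) * real t powr (-1/2)"
      using t assms by (intro mult_right_mono powr_mono2) auto
    finally show "real t powr (-E) \<le> real q powr (1/2 - E) * real t powr (-1/2)" .
  qed
  also have "\<dots> = real q powr (1/2 - E) * (\<Sum>t=1..<q. real t powr (-1/2))"
    by (simp add: sum_distrib_left)
  also have "\<dots> \<le> real q powr (1/2 - E) * (\<Sum>t=1..q. real t powr (-1/2))"
    by (intro mult_left_mono sum_mono2) auto
  also have "\<dots> \<le> real q powr (1/2 - E) * (2 * real q powr (1/2))"
    by (intro mult_left_mono sum_inverse_sqrt_le) auto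
  also have "\<dots> = 2 * real q powr (1 - E)"
    by (simp add: powr_add[symmetric])
  finally show ?thesis .
qed

text \<open>If the sum is nontrivial, it is differenced with shifts up to \<open>\<rho> = \<mu>\<^bsup>-2F\<^esup>\<close>, \<open>F = E / (2 (1 + E))\<close>:
  this choice makes \<open>1 / \<rho>\<close> equal to \<open>(\<rho> \<mu>)\<^bsup>E\<^esup>\<close>.\<close>

lemma van_der_corput_step:
  fixes f :: "nat \<Rightarrow> real" and A \<mu> d :: real
  assumes E: "0 < E" "E \<le> 1/2" and d: "0 \<le> d" "d \<le> 1" and A: "1 \<le> A" and mu: "0 < \<mu>"
    and IH: "\<And>t. 1 \<le> t \<Longrightarrow> t < L \<Longrightarrow> norm (\<Sum>n<L-t. ee (f (n + t) - f n))
       \<le> A * (real (L - t) * (real t * \<mu>) powr E + real (L - t) powr (1 - d) * (real t * \<mu>) powr (-E))"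
  shows "norm (\<Sum>n<L. ee (f n)) \<le> 16 * A * (real L * \<mu> powr (E / (2 * (1 + E)))
            + real L powr (1 - d/2) * \<mu> powr (-(E / (2 * (1 + E)))))"
proof -
  define F where "F = E / (2 * (1 + E))"
  define \<rho> where "\<rho> = \<mu> powr (- 2 * F)"
  define S where "S = norm (\<Sum>n<L. ee (f n))"
  have F0: "0 < F" using E by (simp add: F_def)
  have rho0: "0 < \<rho>" using mu by (simp add: \<rho>_def)
  have SL: "S \<le> real L"
    using sum_norm_le[of "{..<L}" "\<lambda>n. ee (f n)" "\<lambda>_. 1"] by (simp add: S_def)
  have triv: ?thesis if "real L \<le> real L * \<mu> powr F + real L powr (1 - d/2) * \<mu> powr (- F)"
  proof -
    have "S \<le> 1 * (real L * \<mu> powr F + real L powr (1 - d/2) * \<mu> powr (- F))"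
      using SL that by simp
    also have "\<dots> \<le> 16 * A * (real L * \<mu> powr F + real L powr (1 - d/2) * \<mu> powr (- F))"
      using A by (intro mult_right_mono) auto
    finally show ?thesis by (simp add: S_def F_def)
  qed
  consider "1 \<le> \<mu>" | "L = 0" | "\<mu> < 1" "real L < \<rho>" "0 < L" | "\<mu> < 1" "\<rho> \<le> real L" by linarith
  then show ?thesis
  proof cases
    case 1
    then have "1 \<le> \<mu> powr F" using F0 by (simp add: ge_one_powr_ge_zero)
    then have "real L * 1 \<le> real L * \<mu> powr F" by (intro mult_left_mono) auto
    then show ?thesis by (intro triv) (simp add: add_increasing2)
  next
    case 2
    then show ?thesis by simp
  next
    case 3
    \<comment> \<open>Too few terms for shifts up to \<open>\<rho>\<close>, but then the second term
      of the bound already exceeds \<open>L\<close>, since \<open>1 - d/2 \<ge> 1/2\<close>.\<close>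
    have "real L = real L powr (1/2) * real L powr (1/2)"
      using 3 by (simp add: powr_add[symmetric])
    also have "\<dots> \<le> real L powr (1 - d/2) * \<rho> powr (1/2)"
      using 3 d by (intro mult_mono powr_mono powr_mono2) auto
    also have "\<rho> powr (1/2) = \<mu> powr (- F)" by (simp add: \<rho>_def powr_powr)
    finally show ?thesis by (intro triv) (simp add: add_increasing)
  next
    case 4
    define q where "q = nat \<lfloor>\<rho>\<rfloor>"
    have rho1: "1 \<le> \<rho>"
      unfolding \<rho>_def using 4 mu F0 by (simp add: powr_minus_divide powr_le1)
    have "real q = of_int \<lfloor>\<rho>\<rfloor>" "1 \<le> \<lfloor>\<rho>\<rfloor>" using rho1 by (simp_all add: q_def)
    then have q: "1 \<le> q" "real q \<le> \<rho>" "\<rho> \<le> 2 * real q" "q \<le> L"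
      using 4(2) by linarith+
    have rmu: "(\<rho> * \<mu>) powr E = 1 / \<rho>"
    proof -
      have "\<rho> * \<mu> = \<mu> powr (1 - 2 * F)"
        using mu by (simp add: \<rho>_def powr_diff powr_minus_divide)
      then have "(\<rho> * \<mu>) powr E = \<mu> powr ((1 - 2 * F) * E)" by (simp add: powr_powr)
      also have "(1 - 2 * F) * E = 2 * F" using E by (simp add: F_def field_simps)
      also have "\<mu> powr (2 * F) = 1 / \<rho>" by (simp add: \<rho>_def powr_minus_divide)
      finally show ?thesis .
    qed
    have rmu': "(\<rho> * \<mu>) powr (- E) = \<rho>"
      using rmu by (simp add: powr_minus_divide)
    have R: "norm (\<Sum>n<L-t. ee (f (n + t)) * cnj (ee (f n)))
        \<le> A * (real L / \<rho> + real L powr (1 - d) * \<mu> powr (- E) * real t powr (- E))"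
      if t: "t \<in> {1..<q}" for t
    proof -
      have "norm (\<Sum>n<L-t. ee (f (n + t)) * cnj (ee (f n))) = norm (\<Sum>n<L-t. ee (f (n + t) - f n))"
        by (simp add: cis_cnj cis_mult right_diff_distrib)
      also have "\<dots> \<le> A * (real (L - t) * (real t * \<mu>) powr E + real (L - t) powr (1 - d) * (real t * \<mu>) powr (-E))"
        using t q by (intro IH) auto
      \<comment> \<open>In the term growing with \<open>t\<close>, the shift is replaced by
        \<open>\<rho>\<close>; the decaying term keeps \<open>t powr (- E)\<close> for the
        summation.\<close>
      also have "\<dots> \<le> A * (real L * (\<rho> * \<mu>) powr E + real L powr (1 - d) * (real t * \<mu>) powr (-E))"
        using t q A mu E d
        by (intro mult_left_mono add_mono mult_mono powr_mono2 mult_right_mono) auto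
      also have "\<dots> = A * (real L / \<rho> + real L powr (1 - d) * \<mu> powr (- E) * real t powr (- E))"
      proof -
        have "(real t * \<mu>) powr (- E) = \<mu> powr (- E) * real t powr (- E)"
          using mu by (simp add: powr_mult)
        then show ?thesis by (simp add: rmu)
      qed
      finally show ?thesis .
    qed
    have "(\<Sum>t=1..<q. norm (\<Sum>n<L-t. ee (f (n + t)) * cnj (ee (f n))))
        \<le> (\<Sum>t=1..<q. A * (real L / \<rho> + real L powr (1 - d) * \<mu> powr (- E) * real t powr (- E)))"
      by (intro sum_mono R)
    also have "\<dots> = A * (real (q - 1) * (real L / \<rho>)
        + real L powr (1 - d) * \<mu> powr (- E) * (\<Sum>t=1..<q. real t powr (- E)))"
      by (simp add: sum_distrib_left sum.distrib algebra_simps)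
    also have "\<dots> \<le> A * (real q * (real L / \<rho>) + real L powr (1 - d) * \<mu> powr (- E) * (2 * real q powr (1 - E)))"
      using A E rho0
      by (intro mult_left_mono add_mono mult_right_mono sum_powr_neg_le) auto
    also have "real q powr (1 - E) = real q * real q powr (- E)"
      using q by (simp add: powr_diff powr_minus_divide)
    also have "A * (real q * (real L / \<rho>) + real L powr (1 - d) * \<mu> powr (- E) * (2 * (real q * real q powr (- E))))
       = real q * (A * (real L / \<rho> + 2 * real L powr (1 - d) * (\<mu> powr (- E) * real q powr (- E))))"
      by (simp add: algebra_simps)
    \<comment> \<open>Rounding \<open>\<rho>\<close> down to \<open>q\<close> loses at most a factor
      \<open>2 powr E\<close>, and \<open>(\<rho> * \<mu>) powr (- E) = \<rho>\<close>.\<close>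
    also have "\<mu> powr (- E) * real q powr (- E) \<le> 2 * \<rho>"
    proof -
      have "real q powr (- E) \<le> (\<rho> / 2) powr (- E)"
        using q E rho0 by (intro powr_mono2') auto
      also have "\<dots> = 2 powr E * \<rho> powr (- E)"
        using rho0 by (simp add: powr_divide powr_minus_divide)
      also have "\<dots> \<le> 2 powr 1 * \<rho> powr (- E)"
        using E by (intro mult_right_mono powr_mono) auto
      finally have "\<mu> powr (- E) * real q powr (- E) \<le> \<mu> powr (- E) * (2 * \<rho> powr (- E))"
        by (intro mult_left_mono) auto
      also have "\<dots> = 2 * (\<rho> * \<mu>) powr (- E)" using mu rho0 by (simp add: powr_mult)
      finally show ?thesis by (simp add: rmu')
    qed
    finally have sumR: "(\<Sum>t=1..<q. norm (\<Sum>n<L-t. ee (f (n + t)) * cnj (ee (f n))))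
        \<le> real q * (A * (real L / \<rho> + 2 * real L powr (1 - d) * (2 * \<rho>)))"
      using A by (simp add: mult_left_mono)
    define Y where "Y = real L / \<rho> + 4 * real L powr (1 - d) * \<rho>"
    have Lq: "real L \<le> real q * (2 * real L / \<rho>)"
      using q rho0 by (simp add: field_simps mult_left_mono)
    have "real q * S\<^sup>2 \<le> 2 * real L * (real L + 2 * (real q * (A * Y)))"
    proof -
      have "real q * S\<^sup>2 \<le> 2 * real L * (real L + 2 * (\<Sum>t=1..<q. norm (\<Sum>n<L-t. ee (f (n + t)) * cnj (ee (f n)))))"
        unfolding S_def by (intro weyl_van_der_corput q) auto
      also have "\<dots> \<le> 2 * real L * (real L + 2 * (real q * (A * Y)))"
        using sumR by (intro mult_left_mono add_left_mono) (auto simp: Y_def mult_ac)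
      finally show ?thesis .
    qed
    also have "\<dots> \<le> 2 * real L * (real q * (2 * real L / \<rho>) + 2 * (real q * (A * Y)))"
      using Lq by (intro mult_left_mono add_right_mono) auto
    also have "\<dots> = real q * (2 * real L * (2 * real L / \<rho> + 2 * (A * Y)))"
      by (simp add: algebra_simps)
    finally have "S\<^sup>2 \<le> 2 * real L * (2 * real L / \<rho> + 2 * (A * Y))"
      using q by simp
    also have "\<dots> = 4 * (real L * real L / \<rho>) + 4 * A * (real L * real L / \<rho>) + 16 * A * (real L * real L powr (1 - d) * \<rho>)"
      by (simp add: Y_def algebra_simps)
    also have "\<dots> \<le> 16 * A * (real L * real L / \<rho>) + 16 * A * (real L * real L powr (1 - d) * \<rho>)"
    proof -
      have "(4 + 4 * A) * (real L * real L / \<rho>) \<le> 16 * A * (real L * real L / \<rho>)"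
        using A rho0 by (intro mult_right_mono) auto
      then show ?thesis by (simp add: algebra_simps)
    qed
    also have "real L * real L / \<rho> = (real L * \<mu> powr F)\<^sup>2"
      using mu by (simp add: \<rho>_def power2_eq_square powr_add[symmetric] powr_minus_divide)
    also have "real L * real L powr (1 - d) * \<rho> = (real L powr (1 - d/2) * \<mu> powr (- F))\<^sup>2"
    proof -
      have "real L * real L powr (1 - d) = real L powr (2 - d)"
        by (cases "L = 0") (simp_all add: powr_mult_base)
      then show ?thesis
        using mu by (simp add: \<rho>_def power2_eq_square powr_add[symmetric] mult_ac)
    qed
    finally have "S\<^sup>2 \<le> 16 * A * ((real L * \<mu> powr F)\<^sup>2 + (real L powr (1 - d/2) * \<mu> powr (- F))\<^sup>2)"
      by (simp add: algebra_simps)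
    \<comment> \<open>Prepares the square root: a sum of two squares is at most the square of the
      sum, and \<open>16 * A \<ge> 1\<close>.\<close>
    also have "\<dots> \<le> (16 * A)\<^sup>2 * (real L * \<mu> powr F + real L powr (1 - d/2) * \<mu> powr (- F))\<^sup>2"
    proof (intro mult_mono)
      have "1 * (16 * A) \<le> (16 * A) * (16 * A)" using A by (intro mult_right_mono) auto
      then show "16 * A \<le> (16 * A)\<^sup>2" by (simp add: power2_eq_square)
    qed (auto simp: power2_sum)
    finally have "S\<^sup>2 \<le> (16 * A * (real L * \<mu> powr F + real L powr (1 - d/2) * \<mu> powr (- F)))\<^sup>2"
      by (simp add: power_mult_distrib)
    then have "S \<le> 16 * A * (real L * \<mu> powr F + real L powr (1 - d/2) * \<mu> powr (- F))"
      by (rule power2_le_imp_le) (use A in auto)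
    then show ?thesis by (simp add: S_def F_def)
  qed
qed

text \<open>The exponents produced by iterating \<open>E \<mapsto> E / (2 * (1 + E))\<close> of
  \<open>van_der_corput_step\<close> from the value 1/2 at \<open>k = 2\<close>.\<close>

definition vdc_exp :: "nat \<Rightarrow> real" where "vdc_exp k = 1 / (2 ^ k - 2)"

text \<open>Induction on the order, starting from \<open>second_difference_test\<close>. Each
  differencing step halves the saving \<open>4 / 2 ^ k\<close> in the length and multiplies the
  constant by 16; as \<open>h\<close> is preserved, \<open>A\<close> depends on \<open>k\<close> and
  \<open>h\<close> alone.\<close>

lemma van_der_corput:
  fixes h :: real
  assumes "2 \<le> k" and h: "1 \<le> h"
  shows "\<exists>A\<ge>1. \<forall>f L \<mu>. 0 < \<mu> \<longrightarrow> (\<forall>n<L. \<mu> \<le> (fdiff ^^ k) f n \<and> (fdiff ^^ k) f n \<le> h * \<mu>) \<longrightarrow>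
     norm (\<Sum>n<L. ee (f n)) \<le> A * (real L * \<mu> powr vdc_exp k + real L powr (1 - 4 / 2 ^ k) * \<mu> powr (- vdc_exp k))"
  using assms(1)
proof (induction k rule: dec_induct)
  case base
  show ?case
  proof (intro exI[of _ "10 * h"] conjI allI impI)
    show "1 \<le> 10 * h" using h by simp
    fix f :: "nat \<Rightarrow> real" and L and \<mu> :: real
    assume mu: "0 < \<mu>" and *: "\<forall>n<L. \<mu> \<le> (fdiff ^^ 2) f n \<and> (fdiff ^^ 2) f n \<le> h * \<mu>"
    \<comment> \<open>For \<open>k = 2\<close> the length exponent is 0, and
      \<open>0 powr 0 = 0\<close>, so the empty sum is treated apart.\<close>
    have "norm (\<Sum>n<L. ee (f n)) \<le> (if L = 0 then 0 else 10 * h * (real L * sqrt \<mu> + 1 / sqrt \<mu>))"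
      using * second_difference_test[OF mu h, of L f] by (auto simp: fdiff_def numeral_2_eq_2)
    also have "\<dots> \<le> 10 * h * (real L * \<mu> powr vdc_exp 2 + real L powr (1 - 4 / 2 ^ 2) * \<mu> powr (- vdc_exp 2))"
    proof (cases "L = 0")
      case False
      then show ?thesis by (simp add: vdc_exp_def powr_half_sqrt[symmetric] powr_minus_divide mu less_imp_le)
    qed simp
    finally show "norm (\<Sum>n<L. ee (f n)) \<le> 10 * h * (real L * \<mu> powr vdc_exp 2 + real L powr (1 - 4 / 2 ^ 2) * \<mu> powr (- vdc_exp 2))" .
  qed
next
  case (step k)
  then obtain A where A: "1 \<le> A" and IH: "\<And>f L \<mu>. 0 < \<mu> \<Longrightarrow> (\<forall>n<L. \<mu> \<le> (fdiff ^^ k) f n \<and> (fdiff ^^ k) f n \<le> h * \<mu>) \<Longrightarrow>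
     norm (\<Sum>n<L. ee (f n)) \<le> A * (real L * \<mu> powr vdc_exp k + real L powr (1 - 4 / 2 ^ k) * \<mu> powr (- vdc_exp k))"
    by blast
  have k4: "(4::real) \<le> 2 ^ k"
    using power_increasing[OF \<open>2 \<le> k\<close>, of "2::real"] by simp
  have F: "vdc_exp (Suc k) = vdc_exp k / (2 * (1 + vdc_exp k))"
    using k4 by (simp add: vdc_exp_def field_simps)
  have d: "4 / 2 ^ Suc k = 4 / 2 ^ k / (2::real)" by simp
  show ?case
  proof (intro exI[of _ "16 * A"] conjI allI impI)
    show "1 \<le> 16 * A" using A by simp
    fix f :: "nat \<Rightarrow> real" and L and \<mu> :: real
    assume mu: "0 < \<mu>" and *: "\<forall>n<L. \<mu> \<le> (fdiff ^^ Suc k) f n \<and> (fdiff ^^ Suc k) f n \<le> h * \<mu>"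
    show "norm (\<Sum>n<L. ee (f n)) \<le> 16 * A * (real L * \<mu> powr vdc_exp (Suc k)
        + real L powr (1 - 4 / 2 ^ Suc k) * \<mu> powr (- vdc_exp (Suc k)))"
      unfolding F d
    proof (rule van_der_corput_step)
      fix t assume t: "1 \<le> t" "t < L"
      show "norm (\<Sum>n<L-t. ee (f (n + t) - f n)) \<le> A * (real (L - t) * (real t * \<mu>) powr vdc_exp k
        + real (L - t) powr (1 - 4 / 2 ^ k) * (real t * \<mu>) powr (- vdc_exp k))"
      proof (rule IH)
        show "0 < real t * \<mu>" using t mu by simp
        show "\<forall>n<L-t. real t * \<mu> \<le> (fdiff ^^ k) (\<lambda>n. f (n + t) - f n) n \<and>
            (fdiff ^^ k) (\<lambda>n. f (n + t) - f n) n \<le> h * (real t * \<mu>)"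
        proof (intro allI impI)
          fix n assume n: "n < L - t"
          have "(\<Sum>j<t. \<mu>) \<le> (\<Sum>j<t. (fdiff ^^ Suc k) f (n + j))"
            using * n by (intro sum_mono) auto
          moreover have "(\<Sum>j<t. (fdiff ^^ Suc k) f (n + j)) \<le> (\<Sum>j<t. h * \<mu>)"
            using * n by (intro sum_mono) auto
          ultimately show "real t * \<mu> \<le> (fdiff ^^ k) (\<lambda>n. f (n + t) - f n) n \<and>
            (fdiff ^^ k) (\<lambda>n. f (n + t) - f n) n \<le> h * (real t * \<mu>)"
            unfolding fdiff_funpow_shift_diff_sum by (simp add: mult_ac)
        qed
      qed
    qed (use k4 A mu in \<open>auto simp: vdc_exp_def field_simps\<close>)
  qed
qed

section \<open>Dyadic blocks\<close>

text \<open>The discrete counterpart of the \<open>k\<close>-th derivative of \<open>c / t\<close>,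
  with a rising factorial in place of the power.\<close>

lemma fdiff_funpow_reciprocal:
  fixes c :: real
  assumes "1 \<le> N"
  shows "(fdiff ^^ k) (\<lambda>n. c / real (N + n)) n = (-1) ^ k * c * fact k / pochhammer (real (N + n)) (Suc k)"
proof (induction k arbitrary: n)
  case 0
  then show ?case by simp
next
  case (Suc k)
  define m where "m = real (N + n)"
  have m: "0 < m" using assms by (simp add: m_def)
  \<comment> \<open>The factors shared by the two consecutive rising factorials, which otherwise
    differ only in \<open>m\<close> and \<open>m + 1 + k\<close>.\<close>
  define P where "P = pochhammer (m + 1) k"
  have P: "0 < P" using m by (simp add: P_def pochhammer_pos)
  have p1: "pochhammer m (Suc k) = m * P" by (simp add: P_def pochhammer_rec)
  have p2: "pochhammer (m + 1) (Suc k) = (m + 1 + real k) * P" by (simp add: P_def pochhammer_rec')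
  have p3: "pochhammer m (Suc (Suc k)) = m * ((m + 1 + real k) * P)"
    by (subst pochhammer_rec) (simp only: p2)
  have "(fdiff ^^ Suc k) (\<lambda>n. c / real (N + n)) n
      = (-1) ^ k * c * fact k / pochhammer (m + 1) (Suc k) - (-1) ^ k * c * fact k / pochhammer m (Suc k)"
  proof -
    have "m + 1 = real (N + Suc n)" by (simp add: m_def)
    then show ?thesis unfolding m_def by (simp only: funpow.simps o_apply fdiff_def Suc)
  qed
  also have "\<dots> = (-1) ^ k * c * fact k * (1 / ((m + 1 + real k) * P) - 1 / (m * P))"
    unfolding p1 p2 by (simp add: right_diff_distrib)
  also have "1 / ((m + 1 + real k) * P) - 1 / (m * P) = - (1 + real k) / (m * ((m + 1 + real k) * P))"
  proof -
    have "1 / (r * P) - 1 / (m * P) = (m - r) / (m * (r * P))" if "0 < r" for r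
      using m P that by (simp add: field_simps)
    from this[of "m + 1 + real k"] show ?thesis using m by simp
  qed
  also have "(-1) ^ k * c * fact k * (- (1 + real k) / (m * ((m + 1 + real k) * P)))
      = (-1) ^ Suc k * c * fact (Suc k) / pochhammer m (Suc (Suc k))"
  proof -
    have "(-1) ^ Suc k * c * fact (Suc k) = (-1) ^ k * c * fact k * (- (1 + real k))"
      by (simp add: algebra_simps)
    then show ?thesis unfolding p3 by (simp only: times_divide_eq_right)
  qed
  finally show ?case by (simp only: m_def)
qed

lemma pochhammer_bounds:
  fixes m :: real
  assumes "0 \<le> u" "u \<le> m" "m + real k \<le> v" "j \<le> Suc k"
  shows "u ^ j \<le> pochhammer m j \<and> pochhammer m j \<le> v ^ j"
  using assms(4)
proof (induction j)
  case (Suc j)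
  then have IH: "u ^ j \<le> pochhammer m j" "pochhammer m j \<le> v ^ j" by auto
  have b: "u \<le> m + real j" "m + real j \<le> v" using assms Suc.prems by auto
  have "u * u ^ j \<le> (m + real j) * pochhammer m j"
    using b IH assms by (intro mult_mono) auto
  moreover have "(m + real j) * pochhammer m j \<le> v * v ^ j"
    using b IH assms by (intro mult_mono) (auto intro: order_trans[OF zero_le_power])
  ultimately show ?case by (simp add: pochhammer_rec')
qed simp

text \<open>On a block of length at most \<open>N\<close> the \<open>k + 1\<close> factors in the
  \<open>k\<close>-th difference of the phase lie between \<open>N\<close> and
  \<open>(k + 2) * N\<close>. So this difference has size \<open>x / N ^ (k + 1)\<close> up to the
  ratio \<open>h\<close>, and \<open>van_der_corput\<close> applies with
  \<open>\<mu> = c * y\<close>.\<close>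

lemma exp_sum_reciprocal_bound:
  assumes k: "2 \<le> k"
  shows "\<exists>B>0. \<forall>x>0. \<forall>N\<ge>1. \<forall>L\<le>N. norm (\<Sum>n<L. cis (x / real (N + n)))
    \<le> B * (real N * ((x / real N ^ Suc k) powr vdc_exp k
          + real N powr (- (4 / 2 ^ k)) * (x / real N ^ Suc k) powr (- vdc_exp k)))"
proof -
  define h :: real where "h = (real k + 2) ^ Suc k"
  define c :: real where "c = fact k / (2 * pi * h)"
  have h: "1 \<le> h" unfolding h_def by (rule one_le_power) simp
  have c: "0 < c" using h by (simp add: c_def)
  from van_der_corput[OF k h] obtain A where A: "1 \<le> A" and vdc:
    "\<And>f L \<mu>. 0 < \<mu> \<Longrightarrow> (\<forall>n<L. \<mu> \<le> (fdiff ^^ k) f n \<and> (fdiff ^^ k) f n \<le> h * \<mu>) \<Longrightarrow>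
     norm (\<Sum>n<L. ee (f n)) \<le> A * (real L * \<mu> powr vdc_exp k + real L powr (1 - 4 / 2 ^ k) * \<mu> powr (- vdc_exp k))"
    by blast
  define E where "E = vdc_exp k"
  have k4: "(4::real) \<le> 2 ^ k"
    using power_increasing[OF k, of "2::real"] by simp
  define B where "B = A * (c powr E + c powr (- E))"
  have "0 < B" using A c by (simp add: B_def add_pos_pos)
  moreover have "norm (\<Sum>n<L. cis (x / real (N + n)))
    \<le> B * (real N * ((x / real N ^ Suc k) powr E
          + real N powr (- (4 / 2 ^ k)) * (x / real N ^ Suc k) powr (- E)))"
    if x: "0 < x" and N: "1 \<le> N" and L: "L \<le> N" for x :: real and N L :: nat
  proof -
    define y where "y = x / real N ^ Suc k"
    \<comment> \<open>The sign \<open>(-1) ^ k\<close> makes the \<open>k\<close>-th difference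
      positive; for odd \<open>k\<close> it conjugates the sum, which leaves the norm
      unchanged.\<close>
    define f where "f n = ((-1) ^ k * (x / (2 * pi))) / real (N + n)" for n
    have y: "0 < y" using x N by (simp add: y_def)
    have same: "norm (\<Sum>n<L. cis (x / real (N + n))) = norm (\<Sum>n<L. ee (f n))"
    proof (cases "even k")
      case True
      then show ?thesis by (simp add: f_def)
    next
      case False
      have "(\<Sum>n<L. ee (f n)) = cnj (\<Sum>n<L. cis (x / real (N + n)))"
        using False by (simp add: f_def cis_cnj)
      then show ?thesis by (simp only: complex_mod_cnj)
    qed
    have "norm (\<Sum>n<L. ee (f n)) \<le> A * (real L * (c * y) powr E + real L powr (1 - 4 / 2 ^ k) * (c * y) powr (- E))"
      unfolding E_def
    proof (rule vdc)
      show "0 < c * y" using c y by simp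
      show "\<forall>n<L. c * y \<le> (fdiff ^^ k) f n \<and> (fdiff ^^ k) f n \<le> h * (c * y)"
      proof (intro allI impI)
        fix n assume n: "n < L"
        define P where "P = pochhammer (real (N + n)) (Suc k)"
        have v: "real (N + n) + real k \<le> (real k + 2) * real N"
        proof -
          have "real n \<le> real N" using n L by simp
          moreover have "real k * 1 \<le> real k * real N" using N by (intro mult_left_mono) auto
          ultimately show ?thesis by (simp add: algebra_simps)
        qed
        have P: "real N ^ Suc k \<le> P" "P \<le> ((real k + 2) * real N) ^ Suc k"
          using pochhammer_bounds[OF _ _ v order_refl, of "real N"] by (auto simp: P_def)
        have N0: "0 < real N ^ Suc k" using N by simp
        have P0: "0 < P" using P(1) N0 by linarith
        have "(fdiff ^^ k) f n = (-1) ^ k * ((-1) ^ k * (x / (2 * pi))) * fact k / P"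
          unfolding f_def P_def by (rule fdiff_funpow_reciprocal[OF N])
        also have "\<dots> = ((-1) ^ k * (-1) ^ k) * (x / (2 * pi) * fact k / P)" by simp
        also have "(-1) ^ k * (-1) ^ k = (1::real)" by (simp add: power_mult_distrib[symmetric])
        finally have fd: "(fdiff ^^ k) f n = x / (2 * pi) * fact k / P" by simp
        have "c * y = x / (2 * pi) * fact k / ((real k + 2) * real N) ^ Suc k"
          unfolding c_def y_def h_def power_mult_distrib by (simp add: mult_ac)
        also have "\<dots> \<le> x / (2 * pi) * fact k / P"
          using P P0 x N by (intro divide_left_mono mult_pos_pos) auto
        finally have lo: "c * y \<le> (fdiff ^^ k) f n" using fd by simp
        have "x / (2 * pi) * fact k / P \<le> x / (2 * pi) * fact k / real N ^ Suc k"
          using P P0 x N0 by (intro divide_left_mono mult_pos_pos) auto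
        also have "\<dots> = h * (c * y)"
          using h by (simp add: c_def y_def mult_ac)
        finally show "c * y \<le> (fdiff ^^ k) f n \<and> (fdiff ^^ k) f n \<le> h * (c * y)"
          using lo fd by simp
      qed
    qed
    also have "\<dots> \<le> A * (real N * (c * y) powr E + real N powr (1 - 4 / 2 ^ k) * (c * y) powr (- E))"
      using A L k4 by (intro mult_left_mono add_mono mult_right_mono powr_mono2) auto
    also have "real N powr (1 - 4 / 2 ^ k) = real N * real N powr (- (4 / 2 ^ k))"
      using N by (simp add: powr_diff powr_minus_divide)
    also have "A * (real N * (c * y) powr E + real N * real N powr (- (4 / 2 ^ k)) * (c * y) powr (- E))
      = A * (c powr E * (real N * y powr E) + c powr (- E) * (real N * real N powr (- (4 / 2 ^ k)) * y powr (- E)))"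
      using c y by (simp add: powr_mult mult_ac)
    also have "\<dots> \<le> A * ((c powr E + c powr (- E)) * (real N * y powr E) + (c powr E + c powr (- E)) * (real N * real N powr (- (4 / 2 ^ k)) * y powr (- E)))"
      using A by (intro mult_left_mono add_mono mult_right_mono) auto
    also have "\<dots> = B * (real N * (y powr E + real N powr (- (4 / 2 ^ k)) * y powr (- E)))"
      by (simp add: B_def algebra_simps)
    finally show ?thesis by (simp only: same y_def)
  qed
  ultimately show ?thesis unfolding E_def by blast
qed

text \<open>Partial summation: the decrements of the weights are nonnegative and telescope, so the
  total weight on the partial sums is \<open>a 0\<close>.\<close>

lemma abel_summation_bound:
  fixes a z :: "nat \<Rightarrow> real"
  assumes a0: "\<And>n. 0 \<le> a n" and anti: "\<And>n. a (Suc n) \<le> a n"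
    and Z: "\<And>m. m \<le> L \<Longrightarrow> \<bar>\<Sum>n<m. z n\<bar> \<le> T"
  shows "\<bar>\<Sum>n<L. a n * z n\<bar> \<le> a 0 * T"
proof -
  have eq: "(\<Sum>n<m. a n * z n) = a m * (\<Sum>n<m. z n) + (\<Sum>n<m. (a n - a (Suc n)) * (\<Sum>i<Suc n. z i))" for m
    by (induction m) (simp_all add: algebra_simps)
  have "\<bar>\<Sum>n<L. (a n - a (Suc n)) * (\<Sum>i<Suc n. z i)\<bar> \<le> (\<Sum>n<L. (a n - a (Suc n)) * T)"
  proof (rule order_trans[OF sum_abs], rule sum_mono)
    fix n assume n: "n \<in> {..<L}"
    have "\<bar>(a n - a (Suc n)) * (\<Sum>i<Suc n. z i)\<bar> = (a n - a (Suc n)) * \<bar>\<Sum>i<Suc n. z i\<bar>"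
      using anti[of n] by (simp only: abs_mult)
    also have "\<dots> \<le> (a n - a (Suc n)) * T"
      using n anti[of n] by (intro mult_left_mono Z) auto
    finally show "\<bar>(a n - a (Suc n)) * (\<Sum>i<Suc n. z i)\<bar> \<le> (a n - a (Suc n)) * T" .
  qed
  also have "\<dots> = (a 0 - a L) * T"
    by (simp add: sum_distrib_right[symmetric] sum_lessThan_telescope')
  finally have 1: "\<bar>\<Sum>n<L. (a n - a (Suc n)) * (\<Sum>i<Suc n. z i)\<bar> \<le> (a 0 - a L) * T" .
  have 2: "\<bar>a L * (\<Sum>n<L. z n)\<bar> \<le> a L * T"
    using a0[of L] Z[of L] by (simp add: abs_mult mult_left_mono)
  have "\<bar>\<Sum>n<L. a n * z n\<bar> \<le> a L * T + (a 0 - a L) * T"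
    unfolding eq using 1 2 by (intro order_trans[OF abs_triangle_ineq] add_mono)
  then show ?thesis by (simp add: algebra_simps)
qed

text \<open>The sine is an imaginary part, and the decreasing weight \<open>1 / n\<close> starts at
  \<open>1 / N\<close>, which cancels the factor \<open>N\<close> of
  \<open>exp_sum_reciprocal_bound\<close>.\<close>

lemma sin_block_bound:
  assumes k: "2 \<le> k"
  shows "\<exists>B>0. \<forall>x>0. \<forall>N\<ge>1. \<forall>N'. N \<le> N' \<longrightarrow> N' \<le> 2 * N \<longrightarrow>
    \<bar>\<Sum>n=N..<N'. 1 / real n * sin (x / real n)\<bar>
    \<le> B * ((x / real N ^ Suc k) powr vdc_exp k
          + real N powr (- (4 / 2 ^ k)) * (x / real N ^ Suc k) powr (- vdc_exp k))"
proof -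
  from exp_sum_reciprocal_bound[OF k] obtain B where B: "0 < B" and bd:
    "\<And>x N L. 0 < x \<Longrightarrow> 1 \<le> N \<Longrightarrow> L \<le> N \<Longrightarrow> norm (\<Sum>n<L. cis (x / real (N + n)))
    \<le> B * (real N * ((x / real N ^ Suc k) powr vdc_exp k
          + real N powr (- (4 / 2 ^ k)) * (x / real N ^ Suc k) powr (- vdc_exp k)))"
    by blast
  have "\<bar>\<Sum>n=N..<N'. 1 / real n * sin (x / real n)\<bar>
    \<le> B * ((x / real N ^ Suc k) powr vdc_exp k
          + real N powr (- (4 / 2 ^ k)) * (x / real N ^ Suc k) powr (- vdc_exp k))" (is "_ \<le> B * ?T")
    if x: "0 < x" and N: "1 \<le> N" and N': "N \<le> N'" "N' \<le> 2 * N" for x :: real and N N' :: nat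
  proof -
    have "(\<Sum>n=N..<N'. 1 / real n * sin (x / real n))
        = (\<Sum>n=0+N..<(N'-N)+N. 1 / real n * sin (x / real n))" using N' by simp
    also have "\<dots> = (\<Sum>n<N'-N. 1 / real (N + n) * sin (x / real (N + n)))"
      by (subst sum.shift_bounds_nat_ivl) (simp add: lessThan_atLeast0 add.commute)
    also have "\<bar>\<dots>\<bar> \<le> 1 / real (N + 0) * (B * (real N * ?T))"
    proof (rule abel_summation_bound)
      fix m assume "m \<le> N' - N"
      then have "norm (\<Sum>n<m. cis (x / real (N + n))) \<le> B * (real N * ?T)"
        using N' by (intro bd x N) simp
      moreover have "(\<Sum>n<m. sin (x / real (N + n))) = Im (\<Sum>n<m. cis (x / real (N + n)))"
        by simp
      ultimately show "\<bar>\<Sum>n<m. sin (x / real (N + n))\<bar> \<le> B * (real N * ?T)"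
        using abs_Im_le_cmod[of "\<Sum>n<m. cis (x / real (N + n))"] by linarith
    qed (use N in \<open>auto simp: field_simps\<close>)
    also have "\<dots> = B * ?T" using N by simp
    finally show ?thesis .
  qed
  with B show ?thesis by blast
qed

text \<open>Induction splits off the last block, from \<open>2 ^ J * a\<close> to \<open>b\<close>.
  It may be incomplete, which is why the block bound covers every end up to
  \<open>2 * N\<close>.\<close>

lemma dyadic_sum_bound:
  fixes c :: "nat \<Rightarrow> real"
  assumes T: "0 \<le> T"
    and block: "\<And>N N'. a \<le> N \<Longrightarrow> N < b \<Longrightarrow> N \<le> N' \<Longrightarrow> N' \<le> 2 * N \<Longrightarrow> \<bar>\<Sum>n=N..<N'. c n\<bar> \<le> T"
    and "b \<le> 2 ^ J * a"
  shows "\<bar>\<Sum>n=a..<b. c n\<bar> \<le> real J * T"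
  using block assms(3)
proof (induction J arbitrary: b)
  case 0
  then show ?case by simp
next
  case (Suc J)
  show ?case
  proof (cases "b \<le> 2 ^ J * a")
    case True
    then have "\<bar>\<Sum>n=a..<b. c n\<bar> \<le> real J * T" using Suc.IH[of b] Suc.prems(1) by blast
    then show ?thesis using T by (simp add: algebra_simps)
  next
    case False
    let ?m = "2 ^ J * a"
    have m: "a \<le> ?m" "?m < b" using False by auto
    have "(\<Sum>n=a..<b. c n) = (\<Sum>n=a..<?m. c n) + (\<Sum>n=?m..<b. c n)"
      using m by (simp add: sum.atLeastLessThan_concat)
    moreover have "\<bar>\<Sum>n=a..<?m. c n\<bar> \<le> real J * T"
      using m by (intro Suc.IH Suc.prems(1)) auto
    moreover have "\<bar>\<Sum>n=?m..<b. c n\<bar> \<le> T"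
      using m Suc.prems(2) by (intro Suc.prems(1)) auto
    ultimately show ?thesis by (simp add: algebra_simps)
  qed
qed

section \<open>Choice of the order\<close>

text \<open>On \<open>[0, 1]\<close> the convex function \<open>2 powr u\<close> lies below its
  chord; the proof uses the equivalent concavity of the logarithm on \<open>[1, 2]\<close>.\<close>

lemma two_powr_le_one_plus:
  assumes "0 \<le> u" "u \<le> (1::real)"
  shows "2 powr u \<le> 1 + u"
proof -
  have "u * ln 2 \<le> ln (1 + u)"
    using concave_onD[OF ln_concave, of u 1 2] assms by (simp add: algebra_simps)
  then have "exp (u * ln 2) \<le> exp (ln (1 + u))" by simp
  then show ?thesis using assms by (simp add: powr_def)
qed

lemma hl_delta_mono:
  assumes "0 < e" "e \<le> t"
  shows "hl_delta e \<le> hl_delta t"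
  unfolding hl_delta_def using assms
  by (intro mult_mono powr_mono) (auto simp: field_simps)

text \<open>The order \<open>k\<close> is used for \<open>1/\<theta>\<close> between \<open>k - 1 + 4/2\<^sup>k\<close> and \<open>k + 2/2\<^sup>k\<close>, the points where
  the estimates of consecutive orders have equal strength; there the two savings are \<open>\<theta> 2\<^bsup>1-k\<^esup>\<close>
  and \<open>\<theta> 2\<^bsup>-k\<^esup>\<close>, which exceeds \<open>\<theta> 2\<^bsup>-1/\<theta>\<^esup>\<close> by a fixed factor.\<close>

lemma vdc_savings_exceed_hl_delta:
  assumes e: "0 < e" "e < 1 / 2"
  shows "\<exists>D>hl_delta e. \<exists>m. \<forall>\<theta>. e \<le> \<theta> \<longrightarrow> \<theta> \<le> 2 / 3 \<longrightarrow>
    (\<exists>k\<in>{2..m}. D \<le> (real (Suc k) * \<theta> - 1) * vdc_exp k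
       \<and> D \<le> \<theta> * (4 / 2 ^ k) - (real (Suc k) * \<theta> - 1) * vdc_exp k)"
proof -
  \<comment> \<open>\<open>m\<close> bounds the order uniformly because
    \<open>1 / \<theta> \<le> 1 / e\<close>; the factor \<open>2 powr (1 / 2 ^ m)\<close> in
    \<open>D\<close> is the fixed gain over \<open>hl_delta e\<close>.\<close>
  define m where "m = nat \<lceil>1 / e\<rceil> + 2"
  define D where "D = hl_delta e * 2 powr (1 / 2 ^ m)"
  have d0: "0 < hl_delta e" using e by (simp add: hl_delta_def)
  have M4: "(4::real) \<le> 2 ^ m"
    using power_increasing[of 2 m "2::real"] by (simp add: m_def)
  have gain: "1 < (2::real) powr (1 / 2 ^ m)" by (simp add: gr_one_powr)
  have D_le: "D \<le> 1 / 6"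
  proof -
    have "hl_delta e \<le> hl_delta (1/2)" using e by (intro hl_delta_mono) auto
    also have "\<dots> = 1 / 8" by (simp add: hl_delta_def powr_minus_divide)
    finally have 1: "hl_delta e \<le> 1 / 8" .
    have "(2::real) powr (1 / 2 ^ m) \<le> 1 + 1 / 2 ^ m"
      by (rule two_powr_le_one_plus) (auto simp: field_simps)
    also have "\<dots> \<le> 1 + 1 / 4" using M4 by (simp add: field_simps)
    finally have "D \<le> 1 / 8 * (1 + 1 / 4)"
      unfolding D_def using 1 by (intro mult_mono) auto
    then show ?thesis by simp
  qed
  have "\<exists>k\<in>{2..m}. D \<le> (real (Suc k) * \<theta> - 1) * vdc_exp k
       \<and> D \<le> \<theta> * (4 / 2 ^ k) - (real (Suc k) * \<theta> - 1) * vdc_exp k"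
    if th: "e \<le> \<theta>" "\<theta> \<le> 2 / 3" for \<theta>
  proof (cases "1 / 2 \<le> \<theta>")
    case True
    \<comment> \<open>Order 2 saves \<open>(3 * \<theta> - 1) / 2 \<ge> 1/4\<close> in one term and
      \<open>(1 - \<theta>) / 2\<close> in the other; the latter is smallest at
      \<open>\<theta> = 2/3\<close>, where it is 1/6.\<close>
    then have "D \<le> (real (Suc 2) * \<theta> - 1) * vdc_exp 2
       \<and> D \<le> \<theta> * (4 / 2 ^ 2) - (real (Suc 2) * \<theta> - 1) * vdc_exp 2"
      using D_le th by (simp add: vdc_exp_def field_simps)
    moreover have "2 \<in> {2..m}" by (simp add: m_def)
    ultimately show ?thesis by blast
  next
    case False
    define \<alpha> where "\<alpha> = 1 / \<theta>"
    have th0: "0 < \<theta>" using th e by linarith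
    have al: "2 < \<alpha>" "\<alpha> \<le> 1 / e" using th0 th e False by (auto simp: \<alpha>_def field_simps)
    define k where "k = (LEAST k. 2 \<le> k \<and> \<alpha> \<le> real k + 2 / 2 ^ k)"
    have "\<alpha> \<le> real m + 2 / 2 ^ m"
    proof -
      have "\<alpha> \<le> real m" using al unfolding m_def by linarith
      also have "\<dots> \<le> real m + 2 / 2 ^ m" by simp
      finally show ?thesis .
    qed
    then have ex: "2 \<le> m \<and> \<alpha> \<le> real m + 2 / 2 ^ m" by (simp add: m_def)
    have k: "2 \<le> k" "\<alpha> \<le> real k + 2 / 2 ^ k"
      using LeastI[of "\<lambda>k. 2 \<le> k \<and> \<alpha> \<le> real k + 2 / 2 ^ k", OF ex] by (auto simp: k_def)
    have km: "k \<le> m" unfolding k_def by (rule Least_le) (rule ex)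
    \<comment> \<open>Minimality of \<open>k\<close> excludes \<open>k - 1\<close>, and
      \<open>2 / 2 ^ (k - 1) = 4 / 2 ^ k\<close>; for \<open>k = 2\<close> the left side is
      2.\<close>
    have kl: "real k - 1 + 4 / 2 ^ k \<le> \<alpha>"
    proof (cases "k = 2")
      case True
      then show ?thesis using al by simp
    next
      case False
      obtain j where j: "k = Suc j" "2 \<le> j" using False k by (cases k) auto
      have "\<not> (2 \<le> j \<and> \<alpha> \<le> real j + 2 / 2 ^ j)"
        using not_less_Least[of j "\<lambda>k. 2 \<le> k \<and> \<alpha> \<le> real k + 2 / 2 ^ k"] j by (auto simp: k_def)
      then show ?thesis using j by simp
    qed
    define K :: real where "K = 2 ^ k"
    have K4: "4 \<le> K" using power_increasing[OF k(1), of "2::real"] by (simp add: K_def)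
    have KM: "K \<le> 2 ^ m" using km by (simp add: K_def)
    have Kp: "K = 2 powr real k" by (simp add: K_def powr_realpow)
    \<comment> \<open>An affine coordinate for \<open>\<alpha>\<close>: 0 at the right end
      \<open>k + 2 / K\<close> of its interval and 1 at the left end \<open>k - 1 + 4 / K\<close>.
      The two savings become \<open>\<theta> * (1 + u) / K\<close> and
      \<open>\<theta> * (3 - u) / K\<close>.\<close>
    define u where "u = (real (Suc k) - \<alpha>) * K / (K - 2) - 1"
    have u: "0 \<le> u" "u \<le> 1"
      using k kl K4 by (auto simp: u_def K_def[symmetric] field_simps)
    have be: "real (Suc k) - \<alpha> = (1 - 2 / K) * (1 + u)"
      using K4 by (simp add: u_def field_simps)
    have s: "(real (Suc k) * \<theta> - 1) * vdc_exp k = \<theta> * ((1 + u) / K)"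
    proof -
      have "real (Suc k) * \<theta> - 1 = \<theta> * (real (Suc k) - \<alpha>)"
        using th0 by (simp add: \<alpha>_def field_simps)
      then show ?thesis
        using K4 unfolding be vdc_exp_def K_def[symmetric] by (simp add: field_simps)
    qed
    have D: "D \<le> \<theta> * 2 powr (1 / 2 ^ m - \<alpha>)"
    proof -
      have "D \<le> hl_delta \<theta> * 2 powr (1 / 2 ^ m)"
        unfolding D_def using e th by (intro mult_right_mono hl_delta_mono) auto
      also have "\<dots> = \<theta> * 2 powr (1 / 2 ^ m - \<alpha>)"
        by (simp add: hl_delta_def \<alpha>_def powr_diff powr_minus_divide)
      finally show ?thesis .
    qed
    have mK: "1 / 2 ^ m \<le> 1 / K" using KM K4 by (simp add: field_simps)
    have "2 powr (1 / 2 ^ m - \<alpha>) \<le> 2 powr (u - real k)"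
    proof (intro powr_mono)
      have "2 / K + (real (Suc k) - \<alpha>) - 1 = (1 - 2 / K) * u"
        unfolding be by (simp add: algebra_simps add_divide_distrib)
      also have "\<dots> \<le> 1 * u" using u K4 by (intro mult_right_mono) auto
      finally have "2 / K - \<alpha> \<le> u - real k" by simp
      moreover have "1 / K \<le> 2 / K" using K4 by (simp add: divide_right_mono)
      ultimately show "1 / 2 ^ m - \<alpha> \<le> u - real k" using mK by linarith
    qed simp
    also have "\<dots> = 2 powr u / K" by (simp add: Kp powr_diff)
    also have "\<dots> \<le> (1 + u) / K"
      using two_powr_le_one_plus[OF u] K4 by (intro divide_right_mono) auto
    finally have 1: "\<theta> * 2 powr (1 / 2 ^ m - \<alpha>) \<le> \<theta> * ((1 + u) / K)"
      using th0 by (intro mult_left_mono) auto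
    have "2 powr (1 / 2 ^ m - \<alpha>) \<le> 2 powr (1 - real k)"
    proof (intro powr_mono)
      have "1 / K \<le> 4 / K" using K4 by (simp add: divide_right_mono)
      then show "1 / 2 ^ m - \<alpha> \<le> 1 - real k" using mK kl unfolding K_def[symmetric] by linarith
    qed simp
    also have "\<dots> = 2 / K" by (simp add: Kp powr_diff)
    also have "\<dots> \<le> 4 / K - (1 + u) / K"
      using u K4 by (simp add: field_simps)
    finally have 2: "\<theta> * 2 powr (1 / 2 ^ m - \<alpha>) \<le> \<theta> * (4 / K - (1 + u) / K)"
      using th0 by (intro mult_left_mono) auto
    have "D \<le> (real (Suc k) * \<theta> - 1) * vdc_exp k
       \<and> D \<le> \<theta> * (4 / 2 ^ k) - (real (Suc k) * \<theta> - 1) * vdc_exp k"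
      unfolding s K_def[symmetric] using D 1 2 by (simp add: right_diff_distrib)
    then show ?thesis using k km by auto
  qed
  moreover have "hl_delta e < D" using d0 gain by (simp add: D_def)
  ultimately show ?thesis by blast
qed

section \<open>The tail\<close>

text \<open>Adding \<open>cos t / t\<close> to \<open>Si t\<close> cancels the derivative
  \<open>sin t / t\<close>, leaving \<open>- cos t / t^2\<close>. A further \<open>s / t\<close>
  with \<open>s = 1\<close> or \<open>s = -1\<close> makes the function monotone with limit
  \<open>pi / 2\<close>, which traps \<open>Si y\<close> from both sides.\<close>

lemma Si_asymptotic:
  assumes y: "0 < y"
  shows "\<bar>Si y - pi / 2\<bar> \<le> 2 / y"
proof -
  define H where "H s t = Si t + cos t / t + s / t" for s t :: real
  have der: "(H s has_real_derivative - (cos t + s) / t\<^sup>2) (at t)" if "0 < t" for s t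
    unfolding H_def using that
    by (auto intro!: derivative_eq_intros DERIV_Si simp: field_simps power2_eq_square)
  have lim: "(H s \<longlongrightarrow> pi / 2) at_top" for s
  proof -
    have "((\<lambda>t. cos t / t) \<longlongrightarrow> 0) (at_top :: real filter)"
    proof (rule Lim_null_comparison)
      show "\<forall>\<^sub>F t in at_top. norm (cos t / t) \<le> 1 / t"
        using eventually_gt_at_top[of "0::real"]
        by eventually_elim (auto simp: abs_divide intro!: divide_right_mono)
      show "((\<lambda>t. 1 / t) \<longlongrightarrow> 0) (at_top :: real filter)"
        by (intro tendsto_divide_0[OF tendsto_const] filterlim_at_top_imp_at_infinity filterlim_ident)
    qed
    moreover have "((\<lambda>t. s / t) \<longlongrightarrow> 0) at_top"
      by (intro tendsto_divide_0[OF tendsto_const] filterlim_at_top_imp_at_infinity filterlim_ident)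
    ultimately have "((\<lambda>t. Si t + cos t / t + s / t) \<longlongrightarrow> pi / 2 + 0 + 0) at_top"
      by (intro tendsto_add Si_at_top)
    then show ?thesis by (simp add: H_def[abs_def])
  qed
  have up: "H (-1) y \<le> pi / 2"
  proof (rule tendsto_lowerbound[OF lim])
    show "\<forall>\<^sub>F t in at_top. H (-1) y \<le> H (-1) t"
      using eventually_ge_at_top[of y]
    proof eventually_elim
      case (elim t)
      show ?case
      proof (rule DERIV_nonneg_imp_nondecreasing[OF elim])
        fix v assume v: "y \<le> v" "v \<le> t"
        show "\<exists>D. (H (-1) has_real_derivative D) (at v) \<and> 0 \<le> D"
          using der[of v "-1"] v y by (intro exI conjI) (auto intro!: divide_nonneg_nonneg)
      qed
    qed
  qed simp
  have lo: "pi / 2 \<le> H 1 y"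
  proof (rule tendsto_upperbound[OF lim])
    show "\<forall>\<^sub>F t in at_top. H 1 t \<le> H 1 y"
      using eventually_ge_at_top[of y]
    proof eventually_elim
      case (elim t)
      show ?case
      proof (rule DERIV_nonpos_imp_nonincreasing[OF elim])
        fix v assume v: "y \<le> v" "v \<le> t"
        have "- 1 \<le> cos v" by simp
        then have "- (cos v + 1) / v\<^sup>2 \<le> 0" by (intro divide_nonpos_nonneg) (linarith, simp)
        then show "\<exists>D. (H 1 has_real_derivative D) (at v) \<and> D \<le> 0"
          using der[of v 1] v y by (intro exI conjI) auto
      qed
    qed
  qed simp
  have "\<bar>cos y / y\<bar> \<le> 1 / y" using y by (auto simp: abs_divide intro!: divide_right_mono)
  moreover have "2 / y = 1 / y + 1 / y" "- 1 / y = - (1 / y)" by simp_all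
  ultimately show ?thesis using up lo unfolding H_def by linarith
qed

lemma sin_recip_variation:
  fixes x s t :: real
  assumes x: "0 \<le> x" and st: "0 < s" "s \<le> t" "t \<le> s + 1"
  shows "\<bar>1 / t * sin (x / t) - 1 / s * sin (x / s)\<bar> \<le> (x / s + 1) / s\<^sup>2"
proof (cases "s = t")
  case True
  then show ?thesis using x st by simp
next
  case False
  define D where "D u = - (1 / u\<^sup>2) * sin (x / u) - 1 / u * (cos (x / u) * (x / u\<^sup>2))" for u
  have der: "((\<lambda>u. 1 / u * sin (x / u)) has_real_derivative D u) (at u)" if "0 < u" for u
    unfolding D_def using that
    by (auto intro!: derivative_eq_intros simp: field_simps power2_eq_square)
  obtain u where u: "s < u" "u < t" and eq: "1 / t * sin (x / t) - 1 / s * sin (x / s) = (t - s) * D u"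
    using MVT2[of s t "\<lambda>u. 1 / u * sin (x / u)" D] der st False by force
  have "\<bar>D u\<bar> \<le> 1 / u\<^sup>2 * \<bar>sin (x / u)\<bar> + 1 / u * (\<bar>cos (x / u)\<bar> * (x / u\<^sup>2))"
    unfolding D_def using u st x
    by (intro order_trans[OF abs_triangle_ineq4]) (simp add: abs_mult)
  also have "\<dots> \<le> 1 / u\<^sup>2 * 1 + 1 / u * (1 * (x / u\<^sup>2))"
    using u st x by (intro add_mono mult_left_mono mult_right_mono) auto
  also have "\<dots> = (x / u + 1) / u\<^sup>2" using u st by (simp add: field_simps)
  also have "\<dots> \<le> (x / s + 1) / s\<^sup>2"
    using u st x by (intro frac_le add_mono divide_left_mono power_mono) auto
  finally have "\<bar>D u\<bar> \<le> (x / s + 1) / s\<^sup>2" .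
  then have "(t - s) * \<bar>D u\<bar> \<le> 1 * ((x / s + 1) / s\<^sup>2)"
    using st by (intro mult_mono) auto
  then show ?thesis using eq st by (simp add: abs_mult)
qed

text \<open>\<open>- Si (x / t)\<close> is an antiderivative of \<open>sin (x / t) / t\<close>, and
  its unit increments telescope to \<open>Si (x / M)\<close>. The first two error terms come from
  comparing sum and integral, the third from \<open>Si_asymptotic\<close>.\<close>

lemma hl_tail_bound:
  assumes x: "0 < x" and M: "1 \<le> M"
  shows "\<bar>(\<Sum>n. 1 / real (n + M) * sin (x / real (n + M))) - pi / 2\<bar>
     \<le> 2 * x / (real M)\<^sup>2 + 2 / real M + 2 * real M / x"
proof -
  define \<phi> where "\<phi> t = 1 / t * sin (x / t)" for t
  define G where "G t = - Si (x / t)" for t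
  define g where "g n = G (real (Suc n + M)) - G (real (n + M))" for n
  \<comment> \<open>A majorant built to telescope as well; \<open>K\<close> is negative because the
    later term comes first in the difference \<open>e n\<close>.\<close>
  define K where "K = - 2 * (x / real M + 1)"
  define e where "e n = K / real (Suc n + M) - K / real (n + M)" for n
  have inf: "filterlim (\<lambda>n. real (n + M)) at_infinity sequentially"
    by (intro filterlim_at_top_imp_at_infinity filterlim_compose[OF filterlim_real_sequentially]
        filterlim_add_const_nat_at_top)
  have "(\<lambda>n. Si (x / real (n + M))) \<longlonglongrightarrow> Si 0"
    by (intro isCont_tendsto_compose[OF isCont_Si] tendsto_divide_0[OF tendsto_const inf])
  then have "(\<lambda>n. G (real (n + M))) \<longlonglongrightarrow> - Si 0" unfolding G_def by (rule tendsto_minus)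
  moreover have "Si 0 = 0" by (simp add: Si_def zero_ereal_def)
  ultimately have "(\<lambda>n. G (real (n + M))) \<longlonglongrightarrow> 0" by simp
  from telescope_sums[OF this] have gs: "g sums (Si (x / real M))"
    unfolding g_def[abs_def] by (simp add: G_def)
  have "e sums (0 - K / real (0 + M))"
    unfolding e_def[abs_def] by (rule telescope_sums[OF tendsto_divide_0[OF tendsto_const inf]])
  moreover have "0 - K / real (0 + M) = 2 * (x / real M + 1) / real M"
    by (simp add: K_def diff_divide_distrib add_divide_distrib)
  ultimately have es: "e sums (2 * (x / real M + 1) / real M)" by simp
  have "summable (\<lambda>n. 1 / real (Suc (n + (M - 1))) * sin (x / real (Suc (n + (M - 1)))))"
    using summable_ignore_initial_segment[OF summable_hardy_littlewood_Q[of x], of "M - 1"] .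
  then have ps: "summable (\<lambda>n. \<phi> (real (n + M)))"
    using M by (simp add: \<phi>_def)
  have bound: "norm (\<phi> (real (n + M)) - g n) \<le> e n" for n
  proof -
    let ?s = "real (n + M)"
    have s: "0 < ?s" using M by simp
    have "(G has_real_derivative \<phi> t) (at t)" if "?s \<le> t" for t
    proof -
      have t: "0 < t" using that s by linarith
      have "((\<lambda>t. - Si (x / t)) has_real_derivative - (sin (x / t) / (x / t) * (- x / t\<^sup>2))) (at t)"
        using t x by (auto intro!: derivative_eq_intros DERIV_chain2[OF DERIV_Si] simp: power2_eq_square)
      then show ?thesis using t x unfolding G_def \<phi>_def by (simp add: power2_eq_square)
    qed
    \<comment> \<open>By the mean value theorem the increment \<open>g n\<close> is a value of
      \<open>\<phi>\<close> inside the unit interval, so only the variation of \<open>\<phi>\<close>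
      over that interval matters.\<close>
    then obtain t where t: "?s < t" "t < ?s + 1" "G (?s + 1) - G ?s = (?s + 1 - ?s) * \<phi> t"
      using MVT2[of ?s "?s + 1" G \<phi>] by force
    have "g n = \<phi> t" using t(3) by (simp add: g_def add_ac)
    then have "norm (\<phi> ?s - g n) = \<bar>\<phi> t - \<phi> ?s\<bar>" by simp
    also have "\<dots> \<le> (x / ?s + 1) / ?s\<^sup>2"
      unfolding \<phi>_def using x s t by (intro sin_recip_variation) auto
    also have "\<dots> \<le> (x / real M + 1) / ?s\<^sup>2"
      using x M by (intro divide_right_mono add_right_mono divide_left_mono) auto
    also have "\<dots> = (x / real M + 1) * (1 / ?s\<^sup>2)" by simp
    also have "\<dots> \<le> (x / real M + 1) * (2 * (1 / ?s - 1 / (?s + 1)))"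
    proof (intro mult_left_mono)
      have "1 / s\<^sup>2 \<le> 2 * (1 / s - 1 / (s + 1))" if "1 \<le> s" for s :: real
      proof -
        have "s * (s + 1) \<le> 2 * s\<^sup>2"
          using mult_left_mono[OF that, of s] that by (simp add: power2_eq_square algebra_simps)
        then have "2 / (2 * s\<^sup>2) \<le> 2 / (s * (s + 1))"
          using that by (intro divide_left_mono) auto
        also have "\<dots> = 2 * (1 / s - 1 / (s + 1))" using that by (simp add: field_simps)
        finally show ?thesis by simp
      qed
      then show "1 / ?s\<^sup>2 \<le> 2 * (1 / ?s - 1 / (?s + 1))" using M by simp
    qed (use x in auto)
    also have "\<dots> = e n"
    proof -
      have "c * (2 * (1 / p - 1 / r)) = - 2 * c / r - - 2 * c / p" for c p r :: real
        by (simp add: right_diff_distrib mult.commute)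
      from this[of "x / real M + 1" ?s "?s + 1"] show ?thesis
        unfolding e_def K_def by (simp only: of_nat_add of_nat_Suc add_ac)
    qed
    finally show ?thesis .
  qed
  have "(\<Sum>n. \<phi> (real (n + M))) - Si (x / real M) = (\<Sum>n. \<phi> (real (n + M)) - g n)"
    using suminf_diff[OF ps sums_summable[OF gs]] sums_unique[OF gs] by simp
  also have "norm \<dots> \<le> suminf e"
    by (intro norm_suminf_le bound sums_summable[OF es])
  also have "\<dots> = 2 * (x / real M + 1) / real M" using sums_unique[OF es] by simp
  also have "\<dots> = 2 * x / (real M)\<^sup>2 + 2 / real M"
    using M by (simp add: field_simps power2_eq_square)
  finally have 1: "\<bar>(\<Sum>n. \<phi> (real (n + M))) - Si (x / real M)\<bar> \<le> 2 * x / (real M)\<^sup>2 + 2 / real M"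
    by simp
  have "\<bar>Si (x / real M) - pi / 2\<bar> \<le> 2 / (x / real M)"
    using x M by (intro Si_asymptotic) simp
  also have "\<dots> = 2 * real M / x" by simp
  finally show ?thesis using 1 unfolding \<phi>_def by linarith
qed

section \<open>The asymptotic formula\<close>

text \<open>Only finitely many orders occur, so their constants can be added up. The surplus
  \<open>D - hl_delta e\<close> of the saving pays for the logarithmic number of blocks.\<close>

lemma middle_range_bound:
  assumes e: "0 < e" "e < 1 / 2"
  shows "\<exists>C\<ge>0. \<forall>x\<ge>1. \<bar>\<Sum>n=nat \<lceil>x powr e\<rceil>..<nat \<lceil>x powr (2/3)\<rceil>. 1 / real n * sin (x / real n)\<bar>
      \<le> C * x powr (- hl_delta e)"
proof -
  obtain D m where D: "hl_delta e < D" and ex: "\<And>\<theta>. e \<le> \<theta> \<Longrightarrow> \<theta> \<le> 2 / 3 \<Longrightarrow>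
    \<exists>k\<in>{2..m}. D \<le> (real (Suc k) * \<theta> - 1) * vdc_exp k
       \<and> D \<le> \<theta> * (4 / 2 ^ k) - (real (Suc k) * \<theta> - 1) * vdc_exp k"
    using vdc_savings_exceed_hl_delta[OF e] by blast
  define bounds where "bounds k B \<longleftrightarrow> (\<forall>x>0. \<forall>N\<ge>1. \<forall>N'. N \<le> N' \<longrightarrow> N' \<le> 2 * N \<longrightarrow>
    \<bar>\<Sum>n=N..<N'. 1 / real n * sin (x / real n)\<bar>
    \<le> B * ((x / real N ^ Suc k) powr vdc_exp k
          + real N powr (- (4 / 2 ^ k)) * (x / real N ^ Suc k) powr (- vdc_exp k)))" for k B
  have "\<forall>k\<in>{2..m}. \<exists>B. 0 < B \<and> bounds k B"
    unfolding bounds_def using sin_block_bound by auto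
  then obtain B where "\<forall>k\<in>{2..m}. 0 < B k \<and> bounds k (B k)"
    by (rule bchoice[THEN exE])
  then have B0: "\<And>k. k \<in> {2..m} \<Longrightarrow> 0 < B k" and B: "\<And>k. k \<in> {2..m} \<Longrightarrow> bounds k (B k)"
    by blast+
  define A where "A = 2 * (\<Sum>k\<in>{2..m}. B k)"
  have A0: "0 \<le> A" unfolding A_def using B0 by (intro mult_nonneg_nonneg sum_nonneg) (auto intro: less_imp_le)
  have BA: "2 * B k \<le> A" if "k \<in> {2..m}" for k
    unfolding A_def using that B0 by (intro mult_left_mono member_le_sum) (auto intro: less_imp_le)
  have block: "\<bar>\<Sum>n=N..<N'. 1 / real n * sin (x / real n)\<bar> \<le> A * x powr (- D)"
    if x: "1 \<le> x" and N: "x powr e \<le> real N" "real N < x powr (2/3)" and N': "N \<le> N'" "N' \<le> 2 * N"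
    for x :: real and N N' :: nat
  proof -
    \<comment> \<open>At \<open>x = 1\<close> no \<open>N\<close> satisfies both bounds; excluding
      it makes \<open>ln x\<close> positive, so that \<open>\<theta>\<close> is defined by
      \<open>N = x powr \<theta>\<close>.\<close>
    have x1: "1 < x"
    proof (rule ccontr)
      assume "\<not> 1 < x"
      then have "x = 1" using x by simp
      then show False using N by simp
    qed
    have "0 < x powr e" using x1 by simp
    then have N1: "1 \<le> N" using N(1) by (cases N) auto
    define \<theta> where "\<theta> = ln (real N) / ln x"
    have lx: "0 < ln x" using x1 by simp
    have Np: "real N = x powr \<theta>" using x1 N1 lx by (simp add: \<theta>_def powr_def)
    have th: "e \<le> \<theta>" "\<theta> \<le> 2 / 3"
      using N x1 unfolding Np by (auto simp: powr_le_cancel_iff powr_less_cancel_iff)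
    obtain k where k: "k \<in> {2..m}" and s: "D \<le> (real (Suc k) * \<theta> - 1) * vdc_exp k"
       "D \<le> \<theta> * (4 / 2 ^ k) - (real (Suc k) * \<theta> - 1) * vdc_exp k"
      using ex[OF th] by blast
    have xN: "x / real N ^ Suc k = x powr (1 - real (Suc k) * \<theta>)"
    proof -
      have "real N ^ Suc k = x powr (real (Suc k) * \<theta>)"
        unfolding Np using x1 by (simp add: powr_powr powr_realpow[symmetric] mult.commute del: power_Suc of_nat_Suc)
      then show ?thesis using x1 by (simp add: powr_diff)
    qed
    have "(x / real N ^ Suc k) powr vdc_exp k = x powr (- ((real (Suc k) * \<theta> - 1) * vdc_exp k))"
      unfolding xN powr_powr by (simp add: algebra_simps)
    also have "\<dots> \<le> x powr (- D)" using s x by (intro powr_mono) auto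
    finally have 1: "(x / real N ^ Suc k) powr vdc_exp k \<le> x powr (- D)" .
    have "real N powr (- (4 / 2 ^ k)) * (x / real N ^ Suc k) powr (- vdc_exp k)
        = x powr (- (\<theta> * (4 / 2 ^ k) - (real (Suc k) * \<theta> - 1) * vdc_exp k))"
      unfolding xN unfolding Np powr_powr powr_add[symmetric] by (simp add: algebra_simps)
    also have "\<dots> \<le> x powr (- D)" using s x by (intro powr_mono) auto
    finally have 2: "real N powr (- (4 / 2 ^ k)) * (x / real N ^ Suc k) powr (- vdc_exp k) \<le> x powr (- D)" .
    have "\<bar>\<Sum>n=N..<N'. 1 / real n * sin (x / real n)\<bar>
      \<le> B k * ((x / real N ^ Suc k) powr vdc_exp k
          + real N powr (- (4 / 2 ^ k)) * (x / real N ^ Suc k) powr (- vdc_exp k))"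
      using B[OF k] x N1 N' unfolding bounds_def by auto
    also have "\<dots> \<le> B k * (x powr (- D) + x powr (- D))"
      using B0[OF k] by (intro mult_left_mono add_mono 1 2) auto
    also have "\<dots> = 2 * B k * x powr (- D)" by simp
    also have "\<dots> \<le> A * x powr (- D)" by (intro mult_right_mono BA k) auto
    finally show ?thesis .
  qed
  define c where "c = D - hl_delta e"
  have c: "0 < c" using D by (simp add: c_def)
  define C where "C = (1 / (c * ln 2) + 2) * A"
  have C0: "0 \<le> C" unfolding C_def using A0 c by (intro mult_nonneg_nonneg add_nonneg_nonneg) auto
  moreover have "\<bar>\<Sum>n=nat \<lceil>x powr e\<rceil>..<nat \<lceil>x powr (2/3)\<rceil>. 1 / real n * sin (x / real n)\<bar>
      \<le> C * x powr (- hl_delta e)" if x: "1 \<le> x" for x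
  proof -
    define a b where "a = nat \<lceil>x powr e\<rceil>" and "b = nat \<lceil>x powr (2/3)\<rceil>"
    define J where "J = nat \<lceil>log 2 x\<rceil> + 1"
    have lg: "0 \<le> log 2 x" using x by simp
    have a1: "1 \<le> a"
    proof -
      have "0 < x powr e" using x by simp
      then show ?thesis unfolding a_def by linarith
    qed
    have bJ: "b \<le> 2 ^ J * a"
    proof -
      have "real b \<le> x powr (2/3) + 1" unfolding b_def by (simp add: of_nat_ceiling)
      also have "\<dots> \<le> x powr 1 + x" using x by (intro add_mono powr_mono) auto
      also have "\<dots> = 2 * 2 powr (log 2 x)" using x by simp
      also have "\<dots> \<le> 2 * 2 powr (real (nat \<lceil>log 2 x\<rceil>))"
        using lg by (intro mult_left_mono powr_mono) auto
      also have "\<dots> = 2 ^ J" by (simp add: J_def powr_realpow)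
      finally have "real b \<le> real (2 ^ J)" by simp
      then have "b \<le> 2 ^ J" by (simp only: of_nat_le_iff)
      also have "\<dots> \<le> 2 ^ J * a" using a1 by simp
      finally show ?thesis .
    qed
    have "\<bar>\<Sum>n=a..<b. 1 / real n * sin (x / real n)\<bar> \<le> real J * (A * x powr (- D))"
    proof (rule dyadic_sum_bound[OF _ _ bJ])
      show "0 \<le> A * x powr (- D)" using A0 by simp
      fix N N' assume N: "a \<le> N" "N < b" "N \<le> N'" "N' \<le> 2 * N"
      have "x powr e \<le> real N" using N(1) unfolding a_def by linarith
      moreover have "real N < x powr (2/3)" using N(2) unfolding b_def by linarith
      ultimately show "\<bar>\<Sum>n=N..<N'. 1 / real n * sin (x / real n)\<bar> \<le> A * x powr (- D)"
        using N x by (intro block) auto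
    qed
    also have "\<dots> \<le> ((1 / (c * ln 2) + 2) * x powr c) * (A * x powr (- D))"
    proof (intro mult_right_mono)
      have xc: "1 \<le> x powr c" using x c by (simp add: ge_one_powr_ge_zero)
      have "real J \<le> log 2 x + 2" unfolding J_def using lg by linarith
      also have "log 2 x = ln x / ln 2" by (simp add: log_def)
      \<comment> \<open>The logarithm is at most \<open>x powr c / c\<close>, which turns the
        exponent \<open>- D\<close> into \<open>- hl_delta e\<close>.\<close>
      also have "\<dots> \<le> (x powr c / c) / ln 2" using ln_powr_bound[OF x c] by (intro divide_right_mono) auto
      also have "(x powr c / c) / ln 2 + 2 \<le> (x powr c / c) / ln 2 + 2 * x powr c" using xc by simp
      also have "\<dots> = (1 / (c * ln 2) + 2) * x powr c" by (simp add: algebra_simps)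
      finally show "real J \<le> (1 / (c * ln 2) + 2) * x powr c" by simp
    qed (use A0 in auto)
    also have "\<dots> = C * (x powr c * x powr (- D))" by (simp add: C_def)
    also have "x powr c * x powr (- D) = x powr (- hl_delta e)"
      by (simp add: powr_add[symmetric] c_def)
    finally show ?thesis by (simp add: a_def b_def)
  qed
  ultimately show ?thesis by blast
qed

theorem theorem3:
  fixes \<epsilon> :: real
  assumes "0 < \<epsilon>" and "\<epsilon> < 1 / 2"
  shows "\<exists>C>0. \<forall>x::real. x \<ge> 1 \<longrightarrow>
    \<bar>hardy_littlewood_Q x
      - (\<Sum>n | 1 \<le> n \<and> real n < x powr \<epsilon>. 1 / real n * sin (x / real n))
      - pi / 2\<bar> \<le> C * x powr (- hl_delta \<epsilon>)"
proof -
  obtain C where C: "0 \<le> C" and mid: "\<And>x. 1 \<le> x \<Longrightarrow>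
      \<bar>\<Sum>n=nat \<lceil>x powr \<epsilon>\<rceil>..<nat \<lceil>x powr (2/3)\<rceil>. 1 / real n * sin (x / real n)\<bar> \<le> C * x powr (- hl_delta \<epsilon>)"
    using middle_range_bound[OF assms] by blast
  \<comment> \<open>Since 1/8 is below 1/3, the error \<open>x powr (-1/3)\<close> of the tail is
    absorbed.\<close>
  have d: "hl_delta \<epsilon> \<le> 1 / 8"
  proof -
    have "hl_delta \<epsilon> \<le> hl_delta (1/2)" using assms by (intro hl_delta_mono) auto
    then show ?thesis by (simp add: hl_delta_def powr_minus_divide)
  qed
  have "\<bar>hardy_littlewood_Q x
      - (\<Sum>n | 1 \<le> n \<and> real n < x powr \<epsilon>. 1 / real n * sin (x / real n))
      - pi / 2\<bar> \<le> (C + 8) * x powr (- hl_delta \<epsilon>)" if x: "1 \<le> x" for x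
  proof -
    define t where "t n = 1 / real n * sin (x / real n)" for n
    \<comment> \<open>The cut at \<open>x powr (2/3)\<close> balances the tail errors
      \<open>x / M^2\<close> and \<open>M / x\<close>.\<close>
    define a M where "a = nat \<lceil>x powr \<epsilon>\<rceil>" and "M = nat \<lceil>x powr (2/3)\<rceil>"
    define X where "X = x powr (- hl_delta \<epsilon>)"
    have pe: "1 \<le> x powr \<epsilon>" "x powr \<epsilon> \<le> x powr (2/3)"
      using x assms by (auto simp: ge_one_powr_ge_zero intro!: powr_mono)
    have a1: "1 \<le> a" and aM: "a \<le> M"
      unfolding a_def M_def using pe by (linarith, intro nat_mono ceiling_mono)
    have M1: "1 \<le> M" using a1 aM by linarith
    have Mlo: "x powr (2/3) \<le> real M" unfolding M_def by linarith
    have Mhi: "real M \<le> 2 * x powr (2/3)" unfolding M_def using pe by linarith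
    \<comment> \<open>The strict inequality \<open>real n < x powr \<epsilon>\<close> is what makes
      the ceiling \<open>a\<close> the exact exclusive end.\<close>
    have set: "{n. 1 \<le> n \<and> real n < x powr \<epsilon>} = {1..<a}"
      by (auto simp: a_def) linarith+
    have "hardy_littlewood_Q x = (\<Sum>n. t (Suc n))" by (simp add: hardy_littlewood_Q_def t_def)
    also have "\<dots> = (\<Sum>n. t (Suc (n + (M - 1)))) + (\<Sum>n<M-1. t (Suc n))"
      using suminf_split_initial_segment[OF summable_hardy_littlewood_Q[of x], of "M - 1"]
      by (simp add: t_def)
    also have "(\<Sum>n<M-1. t (Suc n)) = (\<Sum>n=1..<M. t n)"
      by (rule sum.reindex_bij_witness[where i = "\<lambda>n. n - 1" and j = Suc]) auto
    also have "\<dots> = (\<Sum>n=1..<a. t n) + (\<Sum>n=a..<M. t n)"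
      using a1 aM by (simp add: sum.atLeastLessThan_concat)
    also have "(\<Sum>n. t (Suc (n + (M - 1)))) = (\<Sum>n. t (n + M))" using M1 by simp
    finally have Q: "hardy_littlewood_Q x = (\<Sum>n. t (n + M)) + ((\<Sum>n=1..<a. t n) + (\<Sum>n=a..<M. t n))" .
    have "\<bar>(\<Sum>n. t (n + M)) - pi / 2\<bar> \<le> 2 * x / (real M)\<^sup>2 + 2 / real M + 2 * real M / x"
      unfolding t_def using x M1 by (intro hl_tail_bound) auto
    also have "\<dots> \<le> 2 * x powr (-1/3) + 2 * x powr (-2/3) + 4 * x powr (-1/3)"
    proof (intro add_mono)
      have x0: "0 < x powr (2/3)" using x by simp
      have "2 * x / (real M)\<^sup>2 \<le> 2 * x / (x powr (2/3))\<^sup>2"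
        using Mlo x x0 M1 by (intro divide_left_mono power_mono mult_pos_pos) auto
      also have "\<dots> = 2 * (x powr 1 / x powr (4/3))"
        using x by (simp add: power2_eq_square powr_add[symmetric])
      also have "\<dots> = 2 * x powr (-1/3)" by (simp only: powr_diff[symmetric]) simp
      finally show "2 * x / (real M)\<^sup>2 \<le> 2 * x powr (-1/3)" .
      have "2 / real M \<le> 2 / x powr (2/3)"
        using Mlo x0 M1 by (intro divide_left_mono mult_pos_pos) auto
      also have "\<dots> = 2 * x powr (-2/3)" using powr_minus_divide[of x "2/3"] by simp
      finally show "2 / real M \<le> 2 * x powr (-2/3)" .
      have "2 * real M / x \<le> 2 * (2 * x powr (2/3)) / x"
        using Mhi x by (intro divide_right_mono mult_left_mono) auto
      also have "\<dots> = 4 * (x powr (2/3) / x powr 1)" using x by simp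
      also have "\<dots> = 4 * x powr (-1/3)" by (simp only: powr_diff[symmetric]) simp
      finally show "2 * real M / x \<le> 4 * x powr (-1/3)" .
    qed
    also have "\<dots> \<le> 2 * X + 2 * X + 4 * X"
      unfolding X_def using x d by (intro add_mono mult_left_mono powr_mono) auto
    finally have tail: "\<bar>(\<Sum>n. t (n + M)) - pi / 2\<bar> \<le> 8 * X" by simp
    have mid': "\<bar>\<Sum>n=a..<M. t n\<bar> \<le> C * X"
      using mid[OF x] by (simp add: a_def M_def t_def X_def)
    have "\<bar>hardy_littlewood_Q x - (\<Sum>n=1..<a. t n) - pi / 2\<bar> \<le> (C + 8) * X"
      unfolding Q distrib_right using tail mid' by linarith
    then show ?thesis unfolding set by (simp add: t_def X_def)
  qed
  moreover have "0 < C + 8" using C by simp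
  ultimately show ?thesis by blast
qed

end
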